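(* For all $0<\beta<1$ there exist $\lambda^*=\lambda^*(\beta)<\sqrt{2}$, $n^*\geq 0$ and $\gamma<1$ such that for all $0<\lambda<\lambda^*$ and all $n>n^*$, a random configuration $\sigma$ of $n$ particles drawn from the stationary distribution $\pi$ of the Markov chain $\mathcal{M}$ with bias parameter $\lambda$ satisfies $$\mathbb{P}\left(p(\sigma) < \beta\cdot p_{max}\right) \leq \gamma^{\sqrt{n}},$$ where $p_{max}=2n-2$.
   Context: Let $\Gamma$ be the triangular lattice. A configuration of $n$ particles is a set of $n$ vertices ("locations") of $\Gamma$, considered up to translation (rotated copies count as distinct). The configuration is connected if the subgraph of $\Gamma$ induced by the occupied locations is connected. A hole is a maximal finite connected set of unoccupied locations. For a connected configuration $\sigma$ with no holes, $p(\sigma)$ is the length of the closed walk around its single external boundary (an edge traversed twice is counted twice). The Markov chain $\mathcal{M}$ (bias $\lambda>0$) has state space $\Omega$, the set of connected configurations of $n$ particles with no holes. For a location $\ell$, $N(\ell)$ is the set of particles at locations adjacent to $\ell$. For adjacent $\ell,\ell'$, let $\mathbb{S}=N(\ell)\cap N(\ell')$ and $N(\ell\cup\ell')=(N(\ell)\cup N(\ell'))$ minus particles located at $\ell$ or $\ell'$. Property 1: $|\mathbb{S}|\in\{1,2\}$ and every particle in $N(\ell\cup\ell')$ is connected to a particle of $\mathbb{S}$ by a lattice path all of whose vertices are particles of $N(\ell\cup\ell')$. Property 2: $|\mathbb{S}|=0$; each of $\ell,\ell'$ has at least one adjacent particle other than one located at the other location; the particles of $N(\ell)$ not at $\ell'$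 are connected by paths within this set; the particles of $N(\ell')$ not at $\ell$ are connected by paths within this set. One step from $\sigma$: choose a particle $P$ uniformly (location $\ell$), a neighbor $\ell'$ of $\ell$ uniformly among six, and $q$ uniform in $(0,1)$. If $\ell'$ is occupied, do nothing. Otherwise let $t$ (resp. $t'$) be the number of triangular faces incident to $\ell$ (resp. $\ell'$) with all three vertices occupied when $P$ is at $\ell$ (resp. at $\ell'$); move $P$ to $\ell'$ if (1) $\ell$ does not have exactly five occupied neighbors, (2) $\ell,\ell'$ satisfy Property 1 or 2, and (3) $q<\lambda^{t'-t}$; else do nothing. $\pi$ is the stationary distribution of $\mathcal{M}$. *)

theory Defs
  imports Main Complex_Main
begin

text \<open>Locations of the triangular lattice: integer combinations of the unit vectors
  e1 (angle 0) and e2 (angle 60 degrees). The six neighbour directions, in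
  counter-clockwise order, are listed in lattice_dirs.\<close>

type_synonym loc = "int \<times> int"

definition lattice_dirs :: "loc set" where
  "lattice_dirs = {(1,0), (0,1), (-1,1), (-1,0), (0,-1), (1,-1)}"

definition ladd :: "loc \<Rightarrow> loc \<Rightarrow> loc" where
  "ladd u d = (fst u + fst d, snd u + snd d)"

definition adj :: "loc \<Rightarrow> loc \<Rightarrow> bool" where
  "adj u v \<longleftrightarrow> (fst v - fst u, snd v - snd u) \<in> lattice_dirs"

definition rot60 :: "loc \<Rightarrow> loc" where
  "rot60 d = (- snd d, fst d + snd d)"

text \<open>Third vertex of the triangular face to the left of the directed edge u -> v.\<close>
definition left_vertex :: "loc \<Rightarrow> loc \<Rightarrow> loc" where
  "left_vertex u v = ladd u (rot60 (fst v - fst u, snd v - snd u))"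

definition is_triangle :: "loc set \<Rightarrow> bool" where
  "is_triangle T \<longleftrightarrow> card T = 3 \<and> (\<forall>u\<in>T. \<forall>v\<in>T. u \<noteq> v \<longrightarrow> adj u v)"

definition connected_in :: "loc set \<Rightarrow> loc \<Rightarrow> loc \<Rightarrow> bool" where
  "connected_in A x y \<longleftrightarrow> (x, y) \<in> {(u, v). u \<in> A \<and> v \<in> A \<and> adj u v}\<^sup>* \<and> x \<in> A \<and> y \<in> A"

definition conn_set :: "loc set \<Rightarrow> bool" where
  "conn_set A \<longleftrightarrow> (\<forall>x\<in>A. \<forall>y\<in>A. connected_in A x y)"

definition no_holes :: "loc set \<Rightarrow> bool" where
  "no_holes S \<longleftrightarrow> (\<forall>x. x \<notin> S \<longrightarrow> infinite {y. connected_in (- S) x y})"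

definition shift :: "loc \<Rightarrow> loc set \<Rightarrow> loc set" where
  "shift a S = (\<lambda>x. ladd x a) ` S"

definition cls :: "loc set \<Rightarrow> loc set set" where
  "cls S = range (\<lambda>a. shift a S)"

definition rep :: "loc set set \<Rightarrow> loc set" where
  "rep C = (SOME S. S \<in> C)"

definition Omega :: "nat \<Rightarrow> loc set set set" where
  "Omega n = {cls S | S. finite S \<and> card S = n \<and> conn_set S \<and> no_holes S}"

text \<open>Perimeter p: length of the closed boundary walk around the external boundary.
  For a connected hole-free configuration every face of the induced plane graph
  other than a fully occupied lattice triangle is the external face, so the walk
  length equals the number of directed occupied edges (u,v) whose left side borders
  the external face, i.e. whose left triangle is not fully occupied (a bridge is
  counted once in each direction, i.e. twice).\<close>
definition perim :: "loc set \<Rightarrow> nat" where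
  "perim S = card {(u, v). u \<in> S \<and> v \<in> S \<and> adj u v \<and> left_vertex u v \<notin> S}"

definition perimC :: "loc set set \<Rightarrow> nat" where
  "perimC C = perim (rep C)"

definition nbrs :: "loc set \<Rightarrow> loc \<Rightarrow> loc set" where
  "nbrs S l = {x \<in> S. adj l x}"

definition property1 :: "loc set \<Rightarrow> loc \<Rightarrow> loc \<Rightarrow> bool" where
  "property1 S l l' \<longleftrightarrow>
     (let Sh = nbrs S l \<inter> nbrs S l'; N = (nbrs S l \<union> nbrs S l') - {l, l'} in
      card Sh \<in> {1, 2} \<and> (\<forall>x\<in>N. \<exists>s\<in>Sh. connected_in N x s))"

definition property2 :: "loc set \<Rightarrow> loc \<Rightarrow> loc \<Rightarrow> bool" where
  "property2 S l l' \<longleftrightarrow>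
     nbrs S l \<inter> nbrs S l' = {} \<and>
     nbrs S l - {l'} \<noteq> {} \<and> nbrs S l' - {l} \<noteq> {} \<and>
     conn_set (nbrs S l - {l'}) \<and> conn_set (nbrs S l' - {l})"

definition tri_count :: "loc set \<Rightarrow> loc \<Rightarrow> nat" where
  "tri_count S l = card {T. T \<subseteq> S \<and> l \<in> T \<and> is_triangle T}"

definition move :: "loc set \<Rightarrow> loc \<Rightarrow> loc \<Rightarrow> loc set" where
  "move S l l' = insert l' (S - {l})"

definition move_ok :: "loc set \<Rightarrow> loc \<Rightarrow> loc \<Rightarrow> bool" where
  "move_ok S l l' \<longleftrightarrow> card (nbrs S l) \<noteq> 5 \<and> (property1 S l l' \<or> property2 S l l')"

text \<open>Probability that q uniform in (0,1) satisfies q < lambda^(t'-t).\<close>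
definition acc_prob :: "real \<Rightarrow> loc set \<Rightarrow> loc \<Rightarrow> loc \<Rightarrow> real" where
  "acc_prob lam S l l' =
     min 1 (lam powi (int (tri_count (move S l l') l') - int (tri_count S l)))"

definition ind :: "bool \<Rightarrow> real" where
  "ind b = (if b then 1 else 0)"

definition step_prob :: "real \<Rightarrow> loc set \<Rightarrow> loc set set \<Rightarrow> real" where
  "step_prob lam S C' =
     (1 / (6 * real (card S))) *
     (\<Sum>l\<in>S. \<Sum>d\<in>lattice_dirs.
        (let l' = ladd l d in
         if l' \<notin> S \<and> move_ok S l l'
         then acc_prob lam S l l' * ind (cls (move S l l') = C')
              + (1 - acc_prob lam S l l') * ind (cls S = C')
         else ind (cls S = C')))"

definition trans_prob :: "real \<Rightarrow> loc set set \<Rightarrow> loc set set \<Rightarrow> real" where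
  "trans_prob lam C C' = step_prob lam (rep C) C'"

definition stationary :: "real \<Rightarrow> nat \<Rightarrow> (loc set set \<Rightarrow> real) \<Rightarrow> bool" where
  "stationary lam n \<pi> \<longleftrightarrow>
     (\<forall>C\<in>Omega n. 0 \<le> \<pi> C) \<and> (\<Sum>C\<in>Omega n. \<pi> C) = 1 \<and>
     (\<forall>C'\<in>Omega n. (\<Sum>C\<in>Omega n. \<pi> C * trans_prob lam C C') = \<pi> C')"

end

theory Submission
  imports Defs
begin

text \<open>The chain is reversible with respect to the weight \<open>\<lambda>\<close> to the number of occupied triangles, and
  Euler's formula gives \<open>p + #triangles = 2 n - 2\<close> for connected hole-free configurations, so small
  perimeter means many triangles. There are at most \<open>36 ^ (n - 1)\<close> configurations up to translation, and
  a line has weight 1; hence for small \<open>\<lambda>\<close> the configurations with \<open>p < \<beta> (2 n - 2)\<close> carry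
  at most the mass \<open>(36 \<lambda> powr (2 (1 - \<beta>))) ^ (n - 1)\<close>.

  The stationary distribution is known only through its invariance, so one needs that every configuration
  can be moved to a line. This is done by sweeping a column \<open>x = k\<close> from left to right, keeping
  the cells to the left of it arranged in horizontal rows that extend leftwards from cells of
  the column. Euler's formula is a by-product, because the moves used preserve the charge
  \<open>sum of degrees - 2 #triangles\<close>, which is easy to compute for a line.\<close>

subsection \<open>Connectivity, neighbours and triangles\<close>

text \<open>The obstacle of the sweep is a corner: a cell with occupied neighbours in directions
  \<open>(1, 0)\<close> and \<open>(0, -1)\<close> and an empty cell in direction
  \<open>(1, -1)\<close> between them. Its row cannot be folded into the row below, because the
  corner cell touches the rest in two separate places. It may step into the empty cell only if that
  does not split the empty region on the far side, and the cell that prevents this may be such a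
  corner itself; a chain of corners has to be followed to the right until one of them yields.

  All moves used keep the number of arcs formed by the occupied neighbours of the moving cell. For a
  cell with an empty neighbour this number is its degree minus its triangles, which is why the
  charge is invariant.

  The bound obtained for a single class, \<open>\<pi> C \<le> weight lam (rep C)\<close>, is the
  usual weight divided by a partition function that is at least 1 because of the line; it is reached
  by following a maximum of \<open>\<pi>\<close> over weight, so only slides towards a line have to
  be built.\<close>

lemma adj_iff:
  "adj (x, y) (u, v) \<longleftrightarrow> (u = x + 1 \<and> v = y) \<or> (u = x \<and> v = y + 1) \<or> (u = x - 1 \<and> v = y + 1) \<or>
     (u = x - 1 \<and> v = y) \<or> (u = x \<and> v = y - 1) \<or> (u = x + 1 \<and> v = y - 1)"
  unfolding adj_def lattice_dirs_def by (simp only: fst_conv snd_conv insert_iff empty_iff prod.inject) presburger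

lemma adj_sym: "adj u v \<longleftrightarrow> adj v u"
  by (cases u; cases v) (auto simp: adj_iff)

lemma not_adj_self [simp]: "\<not> adj u u"
  by (cases u) (simp add: adj_iff)

lemma connected_in_mem: "connected_in A x y \<Longrightarrow> x \<in> A \<and> y \<in> A"
  by (simp add: connected_in_def)

lemma connected_in_refl: "x \<in> A \<Longrightarrow> connected_in A x x"
  by (simp add: connected_in_def)

lemma connected_in_step:
  assumes "connected_in A x y" "adj y z" "z \<in> A"
  shows "connected_in A x z"
  using assms unfolding connected_in_def by (auto intro: rtrancl_into_rtrancl)

lemma connected_in_adj: "x \<in> A \<Longrightarrow> y \<in> A \<Longrightarrow> adj x y \<Longrightarrow> connected_in A x y"
  by (rule connected_in_step[OF connected_in_refl])

lemma connected_in_trans: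
  "connected_in A x y \<Longrightarrow> connected_in A y z \<Longrightarrow> connected_in A x z"
  unfolding connected_in_def by auto

lemma connected_in_induct [consumes 1, case_names refl step]:
  assumes "connected_in A x y" and "P x"
    and "\<And>y z. connected_in A x y \<Longrightarrow> P y \<Longrightarrow> adj y z \<Longrightarrow> z \<in> A \<Longrightarrow> P z"
  shows "P y"
proof -
  have x: "x \<in> A" using assms(1) by (simp add: connected_in_def)
  have "(x, y) \<in> {(u, v). u \<in> A \<and> v \<in> A \<and> adj u v}\<^sup>*"
    using assms(1) by (simp add: connected_in_def)
  then have "connected_in A x y \<and> P y"
  proof (induction rule: rtrancl_induct)
    case base
    then show ?case using assms(2) x by (simp add: connected_in_refl)
  next
    case (step y z)
    then have z: "adj y z" "z \<in> A" and y: "connected_in A x y" "P y" by auto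
    show ?case using connected_in_step[OF y(1) z] assms(3)[OF y z] by simp
  qed
  then show ?thesis ..
qed

lemma connected_in_sym:
  assumes "connected_in A x y"
  shows "connected_in A y x"
  using assms
proof (induction rule: connected_in_induct)
  case refl
  then show ?case using assms connected_in_mem connected_in_refl by blast
next
  case (step y z)
  have "y \<in> A" using step.hyps(1) connected_in_mem by blast
  then have "connected_in A z y"
    using step.hyps(2,3) connected_in_adj[of z A y] adj_sym[of z y] by simp
  then show ?case using step.IH connected_in_trans by blast
qed

lemma connected_in_mono:
  assumes "connected_in A x y" and "A \<subseteq> B"
  shows "connected_in B x y"
  using assms(1)
proof (induction rule: connected_in_induct)
  case refl
  then show ?case using assms connected_in_mem connected_in_refl by blast
next
  case (step y z)
  then show ?case using assms(2) by (blast intro: connected_in_step)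
qed

lemma conn_set_has_neighbour:
  assumes "conn_set A" "x \<in> A" "y \<in> A" "x \<noteq> y"
  obtains z where "z \<in> A" "adj x z"
proof -
  have "connected_in A y x" using assms by (simp add: conn_set_def)
  then have "x = y \<or> (\<exists>z\<in>A. adj x z)"
  proof (induction rule: connected_in_induct)
    case (step u v)
    then show ?case using connected_in_mem[OF step.hyps(1)] adj_sym[of u v] by auto
  qed (use assms in simp)
  then show ?thesis using assms(4) that by blast
qed

text \<open>A path through \<open>p\<close> can be repaired if any two neighbours of
  \<open>p\<close> stay connected without it. The lemma serves twice: for the particle moving from
  \<open>l\<close> to \<open>l'\<close>, and for the empty cell moving from \<open>l'\<close> to
  \<open>l\<close>.\<close>

lemma conn_set_reroute:
  assumes A: "conn_set A" and p: "p \<in> A" and q: "q \<notin> A"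
    and nb: "\<And>u v. u \<in> A \<Longrightarrow> v \<in> A \<Longrightarrow> adj p u \<Longrightarrow> adj p v \<Longrightarrow> connected_in (insert q (A - {p})) u v"
    and r: "r \<in> A - {p}" "adj q r"
  shows "conn_set (insert q (A - {p}))"
proof -
  let ?B = "insert q (A - {p})"
  have main: "connected_in ?B x y" if "x \<in> A - {p}" "y \<in> A - {p}" for x y
  proof -
    have "connected_in A x y" using A that by (simp add: conn_set_def)
    \<comment> \<open>While the old path stands on \<open>p\<close>, the new one waits at some
      neighbour \<open>w\<close> of \<open>p\<close>.\<close>
    then have "(y \<noteq> p \<longrightarrow> connected_in ?B x y) \<and>
        (y = p \<longrightarrow> (\<exists>w\<in>A. adj p w \<and> connected_in ?B x w))"
    proof (induction rule: connected_in_induct)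
      case refl
      then show ?case using that by (auto intro: connected_in_refl)
    next
      case (step y z)
      show ?case
      proof (cases "y = p")
        case True
        then obtain w where w: "w \<in> A" "adj p w" "connected_in ?B x w" using step by blast
        have "z \<noteq> p" using step True by auto
        then show ?thesis
          using connected_in_trans[OF w(3) nb[OF w(1) step.hyps(3) w(2)]] step.hyps(2) True by simp
      next
        case False
        then have "connected_in ?B x y" using step by blast
        moreover have "adj p y" "y \<in> A" if "z = p"
          using step.hyps(2) that adj_sym connected_in_mem[OF step.hyps(1)] by auto
        ultimately show ?thesis
          using connected_in_step[of ?B x y z] step.hyps(2,3) by blast
      qed
    qed
    then show ?thesis using that by blast
  qed
  have q': "connected_in ?B q y" if "y \<in> A - {p}" for y
    using connected_in_trans[OF connected_in_adj[of q ?B r] main[of r y]] r that by auto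
  show ?thesis
    unfolding conn_set_def
  proof (intro ballI)
    fix x y assume "x \<in> ?B" "y \<in> ?B"
    then show "connected_in ?B x y"
      using main[of x y] q'[of x] q'[of y] connected_in_sym[of ?B q x] connected_in_refl[of q ?B] by blast
  qed
qed

text \<open>Under Property 1 all neighbours of \<open>l\<close> reach a shared particle and hence
  \<open>l'\<close>; under Property 2 they reach each other without leaving the neighbourhood of
  \<open>l\<close>.\<close>

lemma conn_set_move:
  assumes S: "conn_set S" and l: "l \<in> S" "l' \<notin> S"
    and pr: "property1 S l l' \<or> property2 S l l'"
  shows "conn_set (move S l l')"
proof -
  let ?S' = "insert l' (S - {l})"
  define N where "N = (nbrs S l \<union> nbrs S l') - {l, l'}"
  have N: "N \<subseteq> S - {l}" by (auto simp: N_def nbrs_def)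
  have "conn_set ?S'"
    using pr
  proof
    assume "property1 S l l'"
    then have c: "card (nbrs S l \<inter> nbrs S l') \<in> {1, 2}"
      and x: "\<forall>x\<in>N. \<exists>s\<in>nbrs S l \<inter> nbrs S l'. connected_in N x s"
      by (simp_all add: property1_def Let_def N_def)
    have to: "connected_in ?S' u l'" if u: "u \<in> N" for u
    proof -
      obtain s where s: "s \<in> nbrs S l \<inter> nbrs S l'" "connected_in N u s" using x u by blast
      have "connected_in ?S' u s" using s(2) N by (auto intro: connected_in_mono)
      then show ?thesis using s connected_in_step[of ?S' u s l'] adj_sym[of s l']
        by (simp add: nbrs_def)
    qed
    obtain s where s: "s \<in> nbrs S l \<inter> nbrs S l'"
      using c by (cases "nbrs S l \<inter> nbrs S l' = {}") auto
    show ?thesis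
    proof (rule conn_set_reroute[OF S l(1) l(2), of s])
      fix u v assume uv: "u \<in> S" "v \<in> S" "adj l u" "adj l v"
      then have "u \<in> N" "v \<in> N" using l by (auto simp: N_def nbrs_def)
      then show "connected_in ?S' u v" using to connected_in_sym connected_in_trans by blast
    qed (use s in \<open>auto simp: nbrs_def\<close>)
  next
    assume p2: "property2 S l l'"
    then obtain r where r: "r \<in> nbrs S l'" "r \<noteq> l" by (auto simp: property2_def)
    show ?thesis
    proof (rule conn_set_reroute[OF S l(1) l(2), of r])
      fix u v assume uv: "u \<in> S" "v \<in> S" "adj l u" "adj l v"
      then have "u \<in> nbrs S l - {l'}" "v \<in> nbrs S l - {l'}"
        using l by (auto simp: nbrs_def)
      then have "connected_in (nbrs S l - {l'}) u v"
        using p2 unfolding property2_def conn_set_def by blast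
      then show "connected_in ?S' u v"
        by (rule connected_in_mono) (auto simp: nbrs_def)
    qed (use r in \<open>auto simp: nbrs_def\<close>)
  qed
  then show ?thesis by (simp add: move_def)
qed

section \<open>Charge and the counting of triangles\<close>

definition triangles :: "loc set \<Rightarrow> loc set set" where
  "triangles S = {T. T \<subseteq> S \<and> is_triangle T}"

text \<open>Twice the number of edges minus triangles. Hence \<open>2 * card S - charge S\<close> is
  twice the Euler characteristic of the complex formed by the cells, edges and triangles.\<close>

definition charge :: "loc set \<Rightarrow> int" where
  "charge S = int (\<Sum>u\<in>S. card (nbrs S u)) - 2 * int (card (triangles S))"

lemma finite_nbrs [simp]: "finite S \<Longrightarrow> finite (nbrs S u)"
  by (simp add: nbrs_def)

lemma finite_triangles [simp]: "finite S \<Longrightarrow> finite (triangles S)"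
  by (rule finite_subset[of _ "Pow S"]) (auto simp: triangles_def)

lemma card_triangles_remove:
  assumes "finite S" "l \<in> S"
  shows "card (triangles S) = card (triangles (S - {l})) + tri_count S l"
proof -
  have "triangles S = triangles (S - {l}) \<union> {T. T \<subseteq> S \<and> l \<in> T \<and> is_triangle T}"
    by (auto simp: triangles_def)
  moreover have "finite {T. T \<subseteq> S \<and> l \<in> T \<and> is_triangle T}"
    using assms by (auto intro: finite_subset[of _ "Pow S"])
  moreover have "triangles (S - {l}) \<inter> {T. T \<subseteq> S \<and> l \<in> T \<and> is_triangle T} = {}"
    by (auto simp: triangles_def)
  ultimately show ?thesis
    using assms by (simp add: card_Un_disjoint tri_count_def)
qed

lemma sum_card_nbrs_remove:
  assumes "finite S" "l \<in> S"
  shows "(\<Sum>u\<in>S. card (nbrs S u)) = (\<Sum>u\<in>S - {l}. card (nbrs (S - {l}) u)) + 2 * card (nbrs S l)"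
proof -
  have one: "card (nbrs S u) = card (nbrs (S - {l}) u) + (if adj l u then 1 else 0)" for u
  proof (cases "adj l u")
    case True
    then have "nbrs S u = insert l (nbrs (S - {l}) u)" "l \<notin> nbrs (S - {l}) u"
      using assms by (auto simp: nbrs_def adj_sym)
    then show ?thesis using assms True by simp
  next
    case False
    then have "nbrs S u = nbrs (S - {l}) u" by (auto simp: nbrs_def adj_sym)
    then show ?thesis using False by simp
  qed
  have "(\<Sum>u\<in>S - {l}. (if adj l u then 1 else 0)) = card (nbrs S l)"
  proof -
    have "(\<Sum>u\<in>S - {l}. (if adj l u then 1 else (0::nat))) = (\<Sum>u\<in>nbrs S l. 1)"
      using assms by (intro sum.mono_neutral_cong_right) (auto simp: nbrs_def)
    then show ?thesis by simp
  qed
  then have "(\<Sum>u\<in>S - {l}. card (nbrs S u)) = (\<Sum>u\<in>S - {l}. card (nbrs (S - {l}) u)) + card (nbrs S l)"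
    by (simp add: one sum.distrib)
  then show ?thesis using assms by (simp add: sum.remove[of S l])
qed

text \<open>Moving a particle therefore keeps the charge exactly when degree minus triangles agrees
  at its old and new place.\<close>

lemma charge_remove:
  assumes "finite S" "l \<in> S"
  shows "charge S = charge (S - {l}) + 2 * (int (card (nbrs S l)) - int (tri_count S l))"
  using card_triangles_remove[OF assms] sum_card_nbrs_remove[OF assms] by (simp add: charge_def)

lemma adj_left_vertex: "adj u v \<Longrightarrow> adj u (left_vertex u v) \<and> adj v (left_vertex u v)"
proof -
  have "\<forall>d\<in>lattice_dirs. rot60 d \<in> lattice_dirs \<and>
      (fst (rot60 d) - fst d, snd (rot60 d) - snd d) \<in> lattice_dirs"
    unfolding lattice_dirs_def rot60_def by simp
  then show "adj u v \<Longrightarrow> ?thesis"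
    by (auto simp: adj_def left_vertex_def ladd_def algebra_simps)
qed

lemma left_vertex_asym: "adj u v \<Longrightarrow> left_vertex u (left_vertex u v) \<noteq> v"
  by (cases u; cases v) (auto simp: adj_def lattice_dirs_def left_vertex_def ladd_def rot60_def)

lemma common_neighbour_left_vertex:
  assumes "adj u v" "adj u w" "adj v w"
  shows "w = left_vertex u v \<or> v = left_vertex u w"
proof -
  define d where "d = (fst v - fst u, snd v - snd u)"
  define e where "e = (fst w - fst u, snd w - snd u)"
  have "\<forall>d\<in>lattice_dirs. \<forall>e\<in>lattice_dirs.
      (fst e - fst d, snd e - snd d) \<in> lattice_dirs \<longrightarrow> e = rot60 d \<or> d = rot60 e"
    unfolding lattice_dirs_def rot60_def by simp
  moreover have "d \<in> lattice_dirs" "e \<in> lattice_dirs" "(fst e - fst d, snd e - snd d) \<in> lattice_dirs"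
    using assms by (simp_all add: d_def e_def adj_def)
  ultimately have "e = rot60 d \<or> d = rot60 e" by blast
  moreover have "ladd u d = v" "ladd u e = w"
    by (simp_all add: ladd_def d_def e_def)
  moreover have "left_vertex u v = ladd u (rot60 d)" "left_vertex u w = ladd u (rot60 e)"
    by (simp_all add: left_vertex_def d_def e_def)
  ultimately show ?thesis by auto
qed

text \<open>Of the two other vertices of a triangle at \<open>l\<close>, exactly one has the
  remaining one on its left as seen from \<open>l\<close>. This matches triangles with the directed
  edges that \<open>perim\<close> leaves out.\<close>

lemma tri_count_left_vertex:
  assumes "l \<in> S"
  shows "tri_count S l = card {v \<in> S. adj l v \<and> left_vertex l v \<in> S}"
proof -
  let ?f = "\<lambda>v. {l, v, left_vertex l v}"
  have "bij_betw ?f {v \<in> S. adj l v \<and> left_vertex l v \<in> S} {T. T \<subseteq> S \<and> l \<in> T \<and> is_triangle T}"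
  proof (rule bij_betw_imageI)
    show "inj_on ?f {v \<in> S. adj l v \<and> left_vertex l v \<in> S}"
    proof (rule inj_onI)
      fix v w
      assume v: "v \<in> {v \<in> S. adj l v \<and> left_vertex l v \<in> S}"
        and w: "w \<in> {v \<in> S. adj l v \<and> left_vertex l v \<in> S}" and e: "?f v = ?f w"
      have v: "adj l v" using v by simp
      have w: "adj l w" using w by simp
      show "v = w"
      proof (rule ccontr)
        assume ne: "v \<noteq> w"
        have vl: "v \<noteq> l" using v not_adj_self by metis
        have wl: "w \<noteq> l" using w not_adj_self by metis
        have "v \<in> ?f w" using e by blast
        then have 1: "v = left_vertex l w" using ne vl by blast
        have "w \<in> ?f v" using e by blast
        then have 2: "w = left_vertex l v" using ne wl by blast
        show False using left_vertex_asym[OF v] 1 2 by metis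
      qed
    qed
    show "?f ` {v \<in> S. adj l v \<and> left_vertex l v \<in> S} = {T. T \<subseteq> S \<and> l \<in> T \<and> is_triangle T}"
    proof
      show "?f ` {v \<in> S. adj l v \<and> left_vertex l v \<in> S} \<subseteq> {T. T \<subseteq> S \<and> l \<in> T \<and> is_triangle T}"
      proof
        fix T assume "T \<in> ?f ` {v \<in> S. adj l v \<and> left_vertex l v \<in> S}"
        then obtain v where v: "v \<in> S" "adj l v" "left_vertex l v \<in> S" "T = ?f v" by blast
        have a: "adj l (left_vertex l v)" "adj v (left_vertex l v)" using adj_left_vertex v by auto
        then have "l \<noteq> v" "l \<noteq> left_vertex l v" "v \<noteq> left_vertex l v" using v by (metis not_adj_self)+
        then have "card T = 3" using v by simp
        then show "T \<in> {T. T \<subseteq> S \<and> l \<in> T \<and> is_triangle T}"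
          using v a assms by (auto simp: is_triangle_def adj_sym)
      qed
      show "{T. T \<subseteq> S \<and> l \<in> T \<and> is_triangle T} \<subseteq> ?f ` {v \<in> S. adj l v \<and> left_vertex l v \<in> S}"
      proof
        fix T assume "T \<in> {T. T \<subseteq> S \<and> l \<in> T \<and> is_triangle T}"
        then have T: "T \<subseteq> S" "l \<in> T" "card T = 3" "\<forall>u\<in>T. \<forall>v\<in>T. u \<noteq> v \<longrightarrow> adj u v"
          by (auto simp: is_triangle_def)
        have "card (T - {l}) = 2" using T by simp
        then obtain v w where vw: "T - {l} = {v, w}" "v \<noteq> w" by (auto simp: card_2_iff)
        then have Te: "T = {l, v, w}" "v \<noteq> l" "w \<noteq> l" using T by auto
        then have "adj l v" "adj l w" "adj v w" using T vw by auto
        then show "T \<in> ?f ` {v \<in> S. adj l v \<and> left_vertex l v \<in> S}"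
          using common_neighbour_left_vertex[of l v w] Te T(1) by (auto simp: insert_commute)
      qed
    qed
  qed
  then show ?thesis by (simp add: tri_count_def bij_betw_same_card)
qed

subsection \<open>Hexagon pairs and slides\<close>

text \<open>Absence of holes is expressed as connectedness of the complement, so that particles and
  empty cells can be treated by the same rerouting lemma; \<open>no_holes_iff\<close> gives the
  equivalence.\<close>

definition polyhex :: "loc set \<Rightarrow> bool" where
  "polyhex S \<longleftrightarrow> finite S \<and> conn_set S \<and> conn_set (- S)"

text \<open>The invariants are built into the relation, so induction along slides delivers them. The
  last conjunct makes every slide a move that the chain can propose and accept.\<close>

definition slide :: "loc set \<Rightarrow> loc set \<Rightarrow> bool" where
  "slide S S' \<longleftrightarrow> polyhex S \<and> polyhex S' \<and> charge S' = charge S \<and>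
     (\<exists>l l'. l \<in> S \<and> l' \<notin> S \<and> adj l l' \<and> move_ok S l l' \<and> S' = move S l l')"

lemma infinite_loc: "infinite (UNIV :: loc set)"
  by (simp add: finite_prod)

text \<open>An empty cell with six occupied neighbours would be a hole.\<close>

lemma polyhex_free_neighbour:
  assumes "polyhex S" "p \<notin> S"
  obtains q where "adj p q" "q \<notin> S"
proof -
  have "infinite (- S)"
    using assms infinite_loc unfolding polyhex_def by (metis Compl_eq_Diff_UNIV finite_Diff2)
  then have "\<not> - S \<subseteq> {p}" using finite_subset by blast
  then obtain y where "y \<in> - S" "y \<noteq> p" by blast
  then show ?thesis
    using conn_set_has_neighbour[of "- S" p y] assms that by (auto simp: polyhex_def)
qed

text \<open>Two adjacent cells \<open>l\<close>, \<open>l'\<close> and the eight cells around them: \<open>s1\<close>, \<open>s2\<close> are the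
  common neighbours, \<open>a1\<close>, \<open>a2\<close>, \<open>a3\<close> the other neighbours of \<open>l\<close>, and \<open>b1\<close>, \<open>b2\<close>, \<open>b3\<close>
  those of \<open>l'\<close>; the cyclic order is \<open>s1 a1 a2 a3 s2 b1 b2 b3\<close>.\<close>

locale hex_pair =
  fixes l l' s1 a1 a2 a3 s2 b1 b2 b3 :: loc
  assumes nb: "\<And>p. adj l p \<longleftrightarrow> p \<in> {l', s1, a1, a2, a3, s2}"
    and nb': "\<And>p. adj l' p \<longleftrightarrow> p \<in> {b2, b3, s1, l, s2, b1}"
    and dist: "distinct [l, l', s1, a1, a2, a3, s2, b1, b2, b3]"
    and rim: "adj s1 a1" "adj a1 a2" "adj a2 a3" "adj a3 s2" "adj s2 b1" "adj b1 b2" "adj b2 b3" "adj b3 s1"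
    and left: "left_vertex l l' = s1" "left_vertex l s1 = a1" "left_vertex l a1 = a2"
      "left_vertex l a2 = a3" "left_vertex l a3 = s2" "left_vertex l s2 = l'"
    and left': "left_vertex l' l = s2" "left_vertex l' s2 = b1" "left_vertex l' b1 = b2"
      "left_vertex l' b2 = b3" "left_vertex l' b3 = s1" "left_vertex l' s1 = l"
begin

lemma nbrs_l: "l' \<notin> S \<Longrightarrow> nbrs S l = {s1, a1, a2, a3, s2} \<inter> S"
  by (auto simp: nbrs_def nb)

lemma nbrs_l': "nbrs S l' = {b2, b3, s1, l, s2, b1} \<inter> S"
  by (auto simp: nbrs_def nb')

lemma shared: "l' \<notin> S \<Longrightarrow> nbrs S l \<inter> nbrs S l' = {s1, s2} \<inter> S"
  using dist by (auto simp: nbrs_l nbrs_l')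

lemma around: "l' \<notin> S \<Longrightarrow> (nbrs S l \<union> nbrs S l') - {l, l'} = {s1, a1, a2, a3, s2, b1, b2, b3} \<inter> S"
  using dist by (auto simp: nbrs_l nbrs_l')

lemma in_move:
  "l' \<in> move S l l'" "l \<notin> move S l l'"
  "p \<in> {s1, a1, a2, a3, s2, b1, b2, b3} \<Longrightarrow> p \<in> move S l l' \<longleftrightarrow> p \<in> S"
  using dist by (auto simp: move_def)

lemma card_nbrs_l:
  assumes "l' \<notin> S"
  shows "card (nbrs S l) = length (filter (\<lambda>p. p \<in> S) [s1, a1, a2, a3, s2])"
proof -
  have "nbrs S l = set (filter (\<lambda>p. p \<in> S) [s1, a1, a2, a3, s2])"
    unfolding nbrs_l[OF assms] by auto
  moreover have "distinct [s1, a1, a2, a3, s2]" using dist by auto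
  ultimately show ?thesis by (simp only: distinct_card distinct_filter)
qed

lemma card_nbrs_l':
  "card (nbrs (move S l l') l') = length (filter (\<lambda>p. p \<in> S) [b2, b3, s1, s2, b1])"
proof -
  have "nbrs (move S l l') l' = set (filter (\<lambda>p. p \<in> S) [b2, b3, s1, s2, b1])"
    unfolding nbrs_l' using in_move[where S = S] by auto
  moreover have "distinct [b2, b3, s1, s2, b1]" using dist by auto
  ultimately show ?thesis by (simp only: distinct_card distinct_filter)
qed

lemma tri_count_l:
  assumes "l \<in> S" "l' \<notin> S"
  shows "tri_count S l = length (filter (\<lambda>p. p \<in> S \<and> left_vertex l p \<in> S) [s1, a1, a2, a3, s2])"
proof -
  have "{v \<in> S. v \<in> {l', s1, a1, a2, a3, s2} \<and> Q v} =
      set (filter (\<lambda>p. p \<in> S \<and> Q p) [s1, a1, a2, a3, s2])" for Q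
    using assms(2) by auto
  moreover have "distinct [s1, a1, a2, a3, s2]" using dist by auto
  ultimately show ?thesis
    by (simp only: tri_count_left_vertex[OF assms(1)] nb distinct_card distinct_filter)
qed

lemma tri_count_l':
  "tri_count (move S l l') l' =
     length (filter (\<lambda>p. p \<in> move S l l' \<and> left_vertex l' p \<in> move S l l') [b2, b3, s1, s2, b1])"
proof -
  have "{v \<in> move S l l'. v \<in> {b2, b3, s1, l, s2, b1} \<and> Q v} =
      set (filter (\<lambda>p. p \<in> move S l l' \<and> Q p) [b2, b3, s1, s2, b1])" for Q
    using in_move(2)[where S = S] by auto
  moreover have "distinct [b2, b3, s1, s2, b1]" using dist by auto
  ultimately show ?thesis
    by (simp only: tri_count_left_vertex[OF in_move(1)] nb' distinct_card distinct_filter)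
qed

text \<open>For the complement the roles are exchanged: the empty cell travels from
  \<open>l'\<close> to \<open>l\<close>. So \<open>con\<close> reconnects the empty neighbours of
  \<open>l'\<close>, \<open>r\<close> attaches \<open>l\<close> to the empty region, and
  \<open>eq\<close> is the balance of \<open>charge_remove\<close>.\<close>

lemma slideI:
  assumes S: "polyhex S" "l \<in> S" "l' \<notin> S"
    and pr: "property1 S l l' \<or> property2 S l l'" and five: "card (nbrs S l) \<noteq> 5"
    and con: "\<And>u v. u \<notin> S \<Longrightarrow> v \<notin> S \<Longrightarrow> u \<in> {b2, b3, s1, s2, b1} \<Longrightarrow> v \<in> {b2, b3, s1, s2, b1} \<Longrightarrow>
        connected_in (insert l (- S - {l'})) u v"
    and r: "r \<in> {s1, a1, a2, a3, s2}" "r \<notin> S"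
    and eq: "card (nbrs S l) + tri_count (move S l l') l' = card (nbrs (move S l l') l') + tri_count S l"
  shows "slide S (move S l l')"
proof -
  have adj: "adj l l'" by (simp add: nb)
  have fin: "finite S" using S by (simp add: polyhex_def)
  have "conn_set (insert l (- S - {l'}))"
  proof (rule conn_set_reroute)
    show "conn_set (- S)" "l' \<in> - S" "l \<notin> - S" using S by (auto simp: polyhex_def)
    show "r \<in> - S - {l'}" "adj l r" using r dist by (auto simp: nb)
  qed (use con S(2) in \<open>auto simp: nb'\<close>)
  moreover have "insert l (- S - {l'}) = - move S l l'"
    using S dist by (auto simp: move_def)
  ultimately have "polyhex (move S l l')"
    using S conn_set_move[OF _ S(2,3) pr] by (simp add: polyhex_def) (simp add: move_def)
  moreover have "charge (move S l l') = charge S"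
  proof -
    have "move S l l' - {l'} = S - {l}" using S by (auto simp: move_def)
    then show ?thesis
      using charge_remove[of S l] charge_remove[of "move S l l'" l'] S fin eq
      by (auto simp: move_def)
  qed
  ultimately show ?thesis
    using S adj pr five unfolding slide_def move_ok_def by blast
qed

text \<open>The occupied cells around the pair form a single arc through \<open>s1\<close>. Seen
  from \<open>l\<close> and from \<open>l'\<close> it is one arc each, so degree minus triangles is
  1 at both ends.\<close>

lemma slide_one:
  assumes S: "polyhex S" "l \<in> S" "l' \<notin> S"
    and s: "s1 \<in> S" "s2 \<notin> S"
    and a: "a2 \<in> S \<Longrightarrow> a1 \<in> S" "a3 \<notin> S"
    and b: "b2 \<in> S \<Longrightarrow> b3 \<in> S" "b1 \<notin> S"
  shows "slide S (move S l l')"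
proof (rule slideI[OF S])
  let ?N = "{s1, a1, a2, a3, s2, b1, b2, b3} \<inter> S"
  have to: "connected_in ?N x s1" if "x \<in> ?N" for x
  proof -
    have 1: "connected_in ?N s1 s1" by (rule connected_in_refl) (use s in simp)
    have 2: "connected_in ?N s1 a1" if "a1 \<in> S"
      by (rule connected_in_step[OF 1]) (use that rim in auto)
    have 3: "connected_in ?N s1 a2" if "a2 \<in> S"
      by (rule connected_in_step[OF 2]) (use that a rim in auto)
    have 4: "connected_in ?N s1 b3" if "b3 \<in> S"
      by (rule connected_in_step[OF 1]) (use that rim adj_sym in auto)
    have 5: "connected_in ?N s1 b2" if "b2 \<in> S"
      by (rule connected_in_step[OF 4]) (use that b rim adj_sym in auto)
    have "connected_in ?N s1 x" using that s a b 1 2 3 4 5 by auto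
    then show ?thesis by (rule connected_in_sym)
  qed
  have "{s1, s2} \<inter> S = {s1}" using s by auto
  then have "property1 S l l'"
    unfolding property1_def Let_def shared[OF S(3)] around[OF S(3)] using to by auto
  then show "property1 S l l' \<or> property2 S l l'" ..
  show "card (nbrs S l) \<noteq> 5" using card_nbrs_l[OF S(3)] s a by simp
  let ?B = "insert l (- S - {l'})"
  have to: "connected_in ?B u s2" if "u \<notin> S" "u \<in> {b2, b3, s1, s2, b1}" for u
  proof -
    have 1: "connected_in ?B s2 s2" by (rule connected_in_refl) (use s dist in auto)
    have 2: "connected_in ?B s2 b1"
      by (rule connected_in_step[OF 1]) (use b dist rim in auto)
    have 3: "connected_in ?B s2 b2" if "b2 \<notin> S"
      by (rule connected_in_step[OF 2]) (use that dist rim in auto)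
    have 4: "connected_in ?B s2 b3" if "b3 \<notin> S"
      by (rule connected_in_step[OF 3]) (use that b dist rim in auto)
    have "connected_in ?B s2 u" using that s 1 2 3 4 by auto
    then show ?thesis by (rule connected_in_sym)
  qed
  show "connected_in ?B u v" if "u \<notin> S" "v \<notin> S" "u \<in> {b2, b3, s1, s2, b1}" "v \<in> {b2, b3, s1, s2, b1}"
    for u v
    using to[of u] to[of v] that connected_in_sym connected_in_trans by blast
  show "s2 \<in> {s1, a1, a2, a3, s2}" "s2 \<notin> S" using s by auto
  show "card (nbrs S l) + tri_count (move S l l') l' = card (nbrs (move S l l') l') + tri_count S l"
    using S s a b
    by (auto simp: card_nbrs_l card_nbrs_l' tri_count_l tri_count_l' left left' in_move)
qed

text \<open>Both ends see two arcs, one containing \<open>s1\<close> and one containing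
  \<open>s2\<close>: at \<open>l\<close> they are separated by \<open>a2\<close>, at
  \<open>l'\<close> by an empty cell among the \<open>b\<close>s. The condition on \<open>b2\<close>
  excludes a third arc.\<close>

lemma slide_two:
  assumes S: "polyhex S" "l \<in> S" "l' \<notin> S"
    and s: "s1 \<in> S" "s2 \<in> S"
    and a: "a2 \<notin> S"
    and b: "b2 \<in> S \<Longrightarrow> b1 \<in> S \<or> b3 \<in> S"
  shows "slide S (move S l l')"
proof (rule slideI[OF S])
  \<comment> \<open>With all three \<open>b\<close>s occupied the target \<open>l'\<close> would be
    enclosed.\<close>
  obtain q where q: "adj l' q" "q \<notin> S" using polyhex_free_neighbour[OF S(1,3)] .
  then have nall: "\<not> (b1 \<in> S \<and> b2 \<in> S \<and> b3 \<in> S)" using s S by (auto simp: nb')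
  let ?N = "{s1, a1, a2, a3, s2, b1, b2, b3} \<inter> S"
  have to: "\<exists>s\<in>{s1, s2}. connected_in ?N x s" if "x \<in> ?N" for x
  proof -
    have 1: "connected_in ?N s1 s1" "connected_in ?N s2 s2"
      by (rule connected_in_refl; use s in simp)+
    have 2: "connected_in ?N s1 a1" if "a1 \<in> S"
      by (rule connected_in_step[OF 1(1)]) (use that rim in auto)
    have 3: "connected_in ?N s2 a3" if "a3 \<in> S"
      by (rule connected_in_step[OF 1(2)]) (use that rim adj_sym in auto)
    have 4: "connected_in ?N s1 b3" if "b3 \<in> S"
      by (rule connected_in_step[OF 1(1)]) (use that rim adj_sym in auto)
    have 5: "connected_in ?N s2 b1" if "b1 \<in> S"
      by (rule connected_in_step[OF 1(2)]) (use that rim in auto)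
    have 6: "connected_in ?N s1 b2" if "b2 \<in> S" "b3 \<in> S"
      by (rule connected_in_step[OF 4]) (use that rim adj_sym in auto)
    have 7: "connected_in ?N s2 b2" if "b2 \<in> S" "b1 \<in> S"
      by (rule connected_in_step[OF 5]) (use that rim in auto)
    have "connected_in ?N s1 x \<or> connected_in ?N s2 x"
      using that s a b 1 2 3 4 5 6 7 by auto
    then show ?thesis by (auto dest: connected_in_sym)
  qed
  have e: "{s1, s2} \<inter> S = {s1, s2}" using s by auto
  have "property1 S l l'"
    unfolding property1_def Let_def shared[OF S(3)] around[OF S(3)] e using to dist by auto
  then show "property1 S l l' \<or> property2 S l l'" ..
  show "card (nbrs S l) \<noteq> 5" using card_nbrs_l[OF S(3)] s a by auto
  let ?B = "insert l (- S - {l'})"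
  show "connected_in ?B u v" if "u \<notin> S" "v \<notin> S" "u \<in> {b2, b3, s1, s2, b1}" "v \<in> {b2, b3, s1, s2, b1}"
    for u v
  proof -
    have in_B: "x \<in> ?B" if "x \<in> {b1, b2, b3}" "x \<notin> S" for x using that dist by auto
    have r: "connected_in ?B x x" if "x \<in> {b1, b2, b3}" "x \<notin> S" for x
      using in_B[OF that] by (rule connected_in_refl)
    have 12: "connected_in ?B b1 b2" if "b1 \<notin> S" "b2 \<notin> S"
      using in_B that rim by (intro connected_in_adj) auto
    have 23: "connected_in ?B b2 b3" if "b2 \<notin> S" "b3 \<notin> S"
      using in_B that rim by (intro connected_in_adj) auto
    have 13: "connected_in ?B b1 b3" if "b1 \<notin> S" "b3 \<notin> S"
      using that b 12 23 connected_in_trans by blast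
    have uv: "u \<in> {b1, b2, b3}" "v \<in> {b1, b2, b3}" using that s by auto
    then show ?thesis
      using uv that(1,2) r[of b1] r[of b2] r[of b3] 12 23 13 12[THEN connected_in_sym] 23[THEN connected_in_sym]
        13[THEN connected_in_sym] by auto
  qed
  show "a2 \<in> {s1, a1, a2, a3, s2}" "a2 \<notin> S" using a by auto
  show "card (nbrs S l) + tri_count (move S l l') l' = card (nbrs (move S l l') l') + tri_count S l"
    using S s a b nall
    by (auto simp: card_nbrs_l card_nbrs_l' tri_count_l tri_count_l' left left' in_move)
qed

text \<open>The Property 2 case, with one arc at each end. Before the move \<open>s1\<close> and
  \<open>s2\<close> are the only empty neighbours of \<open>l'\<close>; afterwards the vacated cell
  \<open>l\<close> joins them.\<close>

lemma slide_none:
  assumes S: "polyhex S" "l \<in> S" "l' \<notin> S"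
    and s: "s1 \<notin> S" "s2 \<notin> S"
    and a: "a1 \<in> S \<or> a2 \<in> S \<or> a3 \<in> S" "a1 \<in> S \<Longrightarrow> a3 \<in> S \<Longrightarrow> a2 \<in> S"
    and b: "b1 \<in> S" "b2 \<in> S" "b3 \<in> S"
  shows "slide S (move S l l')"
proof (rule slideI[OF S])
  have A: "nbrs S l - {l'} = {a1, a2, a3} \<inter> S" using S s dist by (auto simp: nbrs_l)
  have B: "nbrs S l' - {l} = {b1, b2, b3}" using S s b dist by (auto simp: nbrs_l')
  have cA: "conn_set ({a1, a2, a3} \<inter> S)"
  proof -
    let ?A = "{a1, a2, a3} \<inter> S"
    have r: "connected_in ?A x x" if "x \<in> ?A" for x using that by (rule connected_in_refl)
    have 12: "connected_in ?A a1 a2" if "a1 \<in> S" "a2 \<in> S"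
      using that rim by (intro connected_in_adj) auto
    have 23: "connected_in ?A a2 a3" if "a2 \<in> S" "a3 \<in> S"
      using that rim by (intro connected_in_adj) auto
    have 13: "connected_in ?A a1 a3" if "a1 \<in> S" "a3 \<in> S"
      using that a 12 23 connected_in_trans by blast
    show ?thesis
      unfolding conn_set_def
      using r[of a1] r[of a2] r[of a3] 12 23 13 12[THEN connected_in_sym] 23[THEN connected_in_sym] 13[THEN connected_in_sym]
      by auto
  qed
  have cB: "conn_set {b1, b2, b3}"
  proof -
    let ?A = "{b1, b2, b3}"
    have r: "connected_in ?A x x" if "x \<in> ?A" for x using that by (rule connected_in_refl)
    have 12: "connected_in ?A b1 b2" using rim by (intro connected_in_adj) auto
    have 23: "connected_in ?A b2 b3" using rim by (intro connected_in_adj) auto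
    have 13: "connected_in ?A b1 b3" using 12 23 connected_in_trans by blast
    show ?thesis
      unfolding conn_set_def
      using r[of b1] r[of b2] r[of b3] 12 23 13 12[THEN connected_in_sym] 23[THEN connected_in_sym] 13[THEN connected_in_sym]
      by auto
  qed
  have "property2 S l l'"
    unfolding property2_def A B shared[OF S(3)] using cA cB s a by auto
  then show "property1 S l l' \<or> property2 S l l'" ..
  show "card (nbrs S l) \<noteq> 5" using card_nbrs_l[OF S(3)] s by simp
  let ?B = "insert l (- S - {l'})"
  have "connected_in ?B l s1" "connected_in ?B l s2"
    by (rule connected_in_adj; use s dist in \<open>auto simp: nb\<close>)+
  then have 12: "connected_in ?B s1 s2" using connected_in_sym connected_in_trans by blast
  have r: "connected_in ?B s1 s1" "connected_in ?B s2 s2"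
    by (rule connected_in_refl; use s dist in auto)+
  show "connected_in ?B u v" if "u \<notin> S" "v \<notin> S" "u \<in> {b2, b3, s1, s2, b1}" "v \<in> {b2, b3, s1, s2, b1}"
    for u v
    using that b r 12 12[THEN connected_in_sym] by auto
  show "s2 \<in> {s1, a1, a2, a3, s2}" "s2 \<notin> S" using s by auto
  show "card (nbrs S l) + tri_count (move S l l') l' = card (nbrs (move S l l') l') + tri_count S l"
    using S s a b
    by (auto simp: card_nbrs_l card_nbrs_l' tri_count_l tri_count_l' left left' in_move)
qed

end

subsection \<open>Slides in coordinates\<close>

lemma hex_pair_push:
  "hex_pair (x, y) (x + 1, y - 1) (x + 1, y) (x, y + 1) (x - 1, y + 1) (x - 1, y) (x, y - 1)
     (x + 1, y - 2) (x + 2, y - 2) (x + 2, y - 1)"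
  by unfold_locales (auto simp: adj_iff left_vertex_def ladd_def rot60_def)

lemma hex_pair_pull:
  "hex_pair (x, y) (x - 1, y + 1) (x - 1, y) (x, y - 1) (x + 1, y - 1) (x + 1, y) (x, y + 1)
     (x - 1, y + 2) (x - 2, y + 2) (x - 2, y + 1)"
  by unfold_locales (auto simp: adj_iff left_vertex_def ladd_def rot60_def)

lemma hex_pair_down:
  "hex_pair (x, y) (x, y - 1) (x + 1, y - 1) (x + 1, y) (x, y + 1) (x - 1, y + 1) (x - 1, y)
     (x - 1, y - 1) (x, y - 2) (x + 1, y - 2)"
  by unfold_locales (auto simp: adj_iff left_vertex_def ladd_def rot60_def)

lemma hex_pair_left:
  "hex_pair (x, y) (x - 1, y) (x, y - 1) (x + 1, y - 1) (x + 1, y) (x, y + 1) (x - 1, y + 1)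
     (x - 2, y + 1) (x - 2, y) (x - 1, y - 1)"
  by unfold_locales (auto simp: adj_iff left_vertex_def ladd_def rot60_def)

lemma slide_push:
  assumes "polyhex S" "(x, y) \<in> S" "(x + 1, y - 1) \<notin> S"
    and "(x + 1, y) \<in> S" "(x, y - 1) \<in> S" "(x - 1, y + 1) \<notin> S"
    and "(x + 2, y - 2) \<in> S \<Longrightarrow> (x + 1, y - 2) \<in> S \<or> (x + 2, y - 1) \<in> S"
  shows "slide S (move S (x, y) (x + 1, y - 1))"
  by (rule hex_pair.slide_two[OF hex_pair_push]) (use assms in auto)

text \<open>The last three cells surround the target on its far side. In \<open>tower\<close> they
  are the blocked corner and its two occupied neighbours.\<close>

lemma slide_pull:
  assumes "polyhex S" "(x, y) \<in> S" "(x - 1, y + 1) \<notin> S"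
    and "(x - 1, y) \<notin> S" "(x, y + 1) \<notin> S"
    and "(x, y - 1) \<in> S \<or> (x + 1, y - 1) \<in> S \<or> (x + 1, y) \<in> S"
    and "(x, y - 1) \<in> S \<Longrightarrow> (x + 1, y) \<in> S \<Longrightarrow> (x + 1, y - 1) \<in> S"
    and "(x - 1, y + 2) \<in> S" "(x - 2, y + 2) \<in> S" "(x - 2, y + 1) \<in> S"
  shows "slide S (move S (x, y) (x - 1, y + 1))"
  by (rule hex_pair.slide_none[OF hex_pair_pull]) (use assms in auto)

lemma slide_down:
  assumes S: "polyhex S" "(x, y) \<in> S" "(x, y - 1) \<notin> S"
    and s: "(x + 1, y - 1) \<in> S" "(x, y + 1) \<notin> S" "(x - 1, y + 1) \<notin> S" "(x - 1, y - 1) \<notin> S"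
    and b: "(x, y - 2) \<in> S \<Longrightarrow> (x + 1, y - 2) \<in> S"
  shows "slide S (move S (x, y) (x, y - 1))"
\<comment> \<open>The left neighbour is the second cell shared with the target, so it decides
  between two arcs and one.\<close>
proof (cases "(x - 1, y) \<in> S")
  case True
  show ?thesis
    by (rule hex_pair.slide_two[OF hex_pair_down]) (use assms True in auto)
next
  case False
  show ?thesis
    by (rule hex_pair.slide_one[OF hex_pair_down]) (use assms False in auto)
qed

lemma slide_left:
  assumes "polyhex S" "(x, y) \<in> S" "(x - 1, y) \<notin> S"
    and "(x, y - 1) \<in> S" "(x - 1, y + 1) \<notin> S" "(x, y + 1) \<notin> S"
    and "(x + 1, y) \<in> S \<Longrightarrow> (x + 1, y - 1) \<in> S"
    and "(x - 2, y) \<notin> S" "(x - 2, y + 1) \<notin> S"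
  shows "slide S (move S (x, y) (x - 1, y))"
  by (rule hex_pair.slide_one[OF hex_pair_left]) (use assms in auto)

section \<open>Moving whole rows\<close>

abbreviation slides :: "loc set \<Rightarrow> loc set \<Rightarrow> bool" where
  "slides \<equiv> slide\<^sup>*\<^sup>*"

lemma slide_card:
  assumes "slide S S'"
  shows "card S' = card S"
proof -
  obtain l l' where "finite S" "l \<in> S" "l' \<notin> S" "S' = move S l l'"
    using assms unfolding slide_def polyhex_def by blast
  then show ?thesis using card_Suc_Diff1[of S l] by (simp add: move_def del: card_Diff_insert)
qed

lemma slides_invariants:
  assumes "slides S S'" "polyhex S"
  shows "polyhex S' \<and> card S' = card S \<and> charge S' = charge S"
  using assms(1)
proof (induction rule: rtranclp_induct)
  case base
  then show ?case using assms(2) by simp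
next
  case (step U V)
  then show ?case using slide_card[of U V] by (auto simp: slide_def)
qed

lemmas slides_polyhex = slides_invariants[THEN conjunct1]

lemma move_move: "p' \<notin> S \<Longrightarrow> p \<noteq> p' \<Longrightarrow> move (move S p p') p' q = move S p q"
  by (auto simp: move_def)

lemma in_move_iff: "q \<in> move S p p' \<longleftrightarrow> q = p' \<or> q \<in> S \<and> q \<noteq> p"
  by (auto simp: move_def)

text \<open>The left end of a row rolls along the row below. Support is required only under the
  cells it departs from, so it can stop at \<open>c\<close>, one place beyond the last supporting
  cell.\<close>

lemma slides_left:
  assumes "polyhex S" "(x, y) \<in> S" "c \<le> x"
    and "\<And>z. z < x \<Longrightarrow> (z, y) \<notin> S" "\<And>z. z \<le> x \<Longrightarrow> (z, y + 1) \<notin> S"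
    and "\<And>z. c < z \<Longrightarrow> z \<le> x \<Longrightarrow> (z, y - 1) \<in> S"
    and "(x + 1, y) \<in> S \<Longrightarrow> (x + 1, y - 1) \<in> S"
  shows "slides S (move S (x, y) (c, y))"
  using assms
proof (induction "nat (x - c)" arbitrary: S x)
  case 0
  then have "x = c" by simp
  then have "move S (x, y) (c, y) = S" using 0 by (auto simp: move_def)
  then show ?case by simp
next
  case (Suc n)
  let ?S = "move S (x, y) (x - 1, y)"
  have cx: "c < x" using Suc.hyps(2) by simp
  have 1: "slide S ?S"
    by (rule slide_left) (use Suc.prems cx in auto)
  then have "polyhex ?S" by (simp add: slide_def)
  then have "slides ?S (move ?S (x - 1, y) (c, y))"
    using Suc.hyps cx Suc.prems by (intro Suc.hyps(1)) (auto simp: in_move_iff)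
  moreover have "move ?S (x - 1, y) (c, y) = move S (x, y) (c, y)"
    using Suc.prems(4)[of "x - 1"] by (intro move_move) auto
  ultimately show ?case using 1 by (metis converse_rtranclp_into_rtranclp)
qed

text \<open>The cells go down one by one from the right; each lowered cell takes over the part of
  \<open>(c + 1, y - 1)\<close> for the next one.\<close>

lemma slides_down:
  assumes "polyhex S" "\<And>x. e \<le> x \<Longrightarrow> x \<le> c \<Longrightarrow> (x, y) \<in> S" "e \<le> c + 1" "(c + 1, y - 1) \<in> S"
    and "\<And>x. x \<le> c \<Longrightarrow> (x, y - 1) \<notin> S" "\<And>x. x \<le> c \<Longrightarrow> (x, y + 1) \<notin> S"
    and "\<And>x. x \<le> c \<Longrightarrow> (x, y - 2) \<in> S \<Longrightarrow> (x + 1, y - 2) \<in> S"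
  shows "slides S ((S - {e..c} \<times> {y}) \<union> {e..c} \<times> {y - 1})"
  using assms
proof (induction "nat (c + 1 - e)" arbitrary: S c)
  case 0
  then have "{e..c} = {}" by simp
  then show ?case by simp
next
  case (Suc n)
  let ?S = "move S (c, y) (c, y - 1)"
  have ec: "e \<le> c" using Suc.hyps(2) by simp
  have 1: "slide S ?S"
    by (rule slide_down) (use Suc.prems ec in auto)
  then have "polyhex ?S" by (simp add: slide_def)
  then have "slides ?S ((?S - {e..c - 1} \<times> {y}) \<union> {e..c - 1} \<times> {y - 1})"
    using Suc.hyps ec Suc.prems by (intro Suc.hyps(1)) (auto simp: in_move_iff)
  moreover have "(?S - {e..c - 1} \<times> {y}) \<union> {e..c - 1} \<times> {y - 1} =
      (S - {e..c} \<times> {y}) \<union> {e..c} \<times> {y - 1}"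
    using ec by (auto simp: in_move_iff)
  ultimately show ?case using 1 by (metis converse_rtranclp_into_rtranclp)
qed

text \<open>The cells \<open>e..K\<close> of row \<open>y\<close> are appended at the left end of
  row \<open>y - 1\<close>, which begins at \<open>c + 1\<close>. Two values of \<open>K\<close>
  occur: \<open>k\<close> for the whole row, and \<open>k - 1\<close> when \<open>(k, y)\<close> has
  already been pushed away. The last hypothesis keeps the right end of the row from being a
  corner.\<close>

lemma slides_drop_row:
  assumes "polyhex S" "k - 1 \<le> K" "K \<le> k" "c < k"
    and "\<And>x z. z \<noteq> y \<Longrightarrow> x < k \<Longrightarrow> (x, z) \<in> S \<Longrightarrow> (x + 1, z) \<in> S"
    and "\<And>x. x \<le> K \<Longrightarrow> (x, y) \<in> S \<longleftrightarrow> e \<le> x" "e \<le> K + 1"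
    and "\<And>x. x \<le> k \<Longrightarrow> (x, y - 1) \<in> S \<longleftrightarrow> c < x"
    and "\<And>x. x \<le> k \<Longrightarrow> (x, y + 1) \<notin> S"
    and "(K + 1, y) \<in> S \<Longrightarrow> (K + 1, y - 1) \<in> S"
  shows "slides S ((S - {e..K} \<times> {y}) \<union> {c - (K - e)..c} \<times> {y - 1})"
  using assms
proof (induction "nat (K + 1 - e)" arbitrary: S e c rule: less_induct)
  case less
  note prems = less.prems
  consider "e = K + 1" | "e \<le> K" "c < e" | "e \<le> K" "e \<le> c" using prems(7) by linarith
  then show ?case
  proof cases
    case 1
    then show ?thesis by simp
  next
    case 2
    \<comment> \<open>Row \<open>y\<close> does not overhang: its left end rolls to column
      \<open>c\<close> and drops to the end of row \<open>y - 1\<close>.\<close>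
    let ?S1 = "move S (e, y) (c, y)" and ?S2 = "move S (e, y) (c, y - 1)"
    have ey: "(e, y) \<in> S" "(c, y) \<notin> S" using prems(6) 2 by auto
    have s1: "slides S ?S1"
    proof (rule slides_left)
      show "(e + 1, y - 1) \<in> S" if "(e + 1, y) \<in> S"
        using that prems(3,8,10) 2 by (cases "e = K") auto
      show "(z, y) \<notin> S" if "z < e" for z
        using prems(6)[of z] that 2 by auto
      show "(z, y + 1) \<notin> S" if "z \<le> e" for z
        using prems(3,9) that 2 by auto
      show "(z, y - 1) \<in> S" if "c < z" "z \<le> e" for z
        using prems(3,8) that 2 by auto
    qed (use prems(1) ey 2 in auto)
    have "slide ?S1 (move ?S1 (c, y) (c, y - 1))"
    proof (rule slide_down)
      show "polyhex ?S1" using s1 prems(1) slides_polyhex by blast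
      show "(c, y - 1) \<notin> ?S1" "(c + 1, y - 1) \<in> ?S1" "(c - 1, y - 1) \<notin> ?S1"
        using prems(4,8) by (auto simp: in_move_iff)
      show "(c, y + 1) \<notin> ?S1" "(c - 1, y + 1) \<notin> ?S1"
        using prems(4,9) by (auto simp: in_move_iff)
      show "(c + 1, y - 2) \<in> ?S1" if "(c, y - 2) \<in> ?S1"
        using that prems(5)[of "y - 2" c] prems(4) by (auto simp: in_move_iff)
    qed (simp add: in_move_iff)
    moreover have "move ?S1 (c, y) (c, y - 1) = ?S2"
      using ey 2 by (intro move_move) auto
    ultimately have s2: "slides S ?S2" using s1 by simp
    have "slides ?S2 ((?S2 - {e + 1..K} \<times> {y}) \<union> {c - 1 - (K - (e + 1))..c - 1} \<times> {y - 1})"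
    proof (rule less.hyps)
      show "polyhex ?S2" using s2 prems(1) slides_polyhex by blast
      show "(x + 1, z) \<in> ?S2" if "z \<noteq> y" "x < k" "(x, z) \<in> ?S2" for x z
        using that prems(5)[of z x] prems(4) prems(8)[of "c + 1"] by (auto simp: in_move_iff)
      show "(x, y) \<in> ?S2 \<longleftrightarrow> e + 1 \<le> x" if "x \<le> K" for x
        using prems(6)[OF that] by (auto simp: in_move_iff)
      show "(x, y - 1) \<in> ?S2 \<longleftrightarrow> c - 1 < x" if "x \<le> k" for x
        using prems(8)[OF that] by (auto simp: in_move_iff)
      show "(x, y + 1) \<notin> ?S2" if "x \<le> k" for x
        using prems(9)[OF that] by (auto simp: in_move_iff)
      show "(K + 1, y - 1) \<in> ?S2" if "(K + 1, y) \<in> ?S2"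
        using that prems(10) by (auto simp: in_move_iff)
    qed (use prems 2 in auto)
    moreover have "(?S2 - {e + 1..K} \<times> {y}) \<union> {c - 1 - (K - (e + 1))..c - 1} \<times> {y - 1} =
        (S - {e..K} \<times> {y}) \<union> {c - (K - e)..c} \<times> {y - 1}"
      using 2 by (auto simp: in_move_iff)
    ultimately show ?thesis using s2 by simp
  next
    case 3
    \<comment> \<open>Row \<open>y\<close> overhangs: the part over empty cells goes straight down.
      Row \<open>y - 1\<close> then begins at \<open>e\<close>, and \<open>c + 1..K\<close> is still
      to be moved.\<close>
    let ?S1 = "(S - {e..c} \<times> {y}) \<union> {e..c} \<times> {y - 1}"
    have cK: "c \<le> K" using prems(2,4) by simp
    have s1: "slides S ?S1"
    proof (rule slides_down)
      show "(x, y) \<in> S" if "e \<le> x" "x \<le> c" for x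
        using prems(6)[of x] that cK by auto
      show "(x, y - 1) \<notin> S" if "x \<le> c" for x
        using prems(8)[of x] that prems(4) by auto
      show "(x, y + 1) \<notin> S" if "x \<le> c" for x
        using prems(9)[of x] that prems(4) by auto
      show "(x + 1, y - 2) \<in> S" if "x \<le> c" "(x, y - 2) \<in> S" for x
        using prems(5)[of "y - 2" x] that prems(4) by auto
      show "(c + 1, y - 1) \<in> S" using prems(8)[of "c + 1"] prems(4) by simp
    qed (use prems(1) 3 in auto)
    have "slides ?S1 ((?S1 - {c + 1..K} \<times> {y}) \<union> {e - 1 - (K - (c + 1))..e - 1} \<times> {y - 1})"
    proof (rule less.hyps)
      show "polyhex ?S1" using s1 prems(1) slides_polyhex by blast
      show "(x + 1, z) \<in> ?S1" if "z \<noteq> y" "x < k" "(x, z) \<in> ?S1" for x z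
        using that prems(5)[of z x] prems(4) prems(8)[of "x + 1"] by auto
      show "(x, y) \<in> ?S1 \<longleftrightarrow> c + 1 \<le> x" if "x \<le> K" for x
        using prems(6)[OF that] 3 by auto
      show "(x, y - 1) \<in> ?S1 \<longleftrightarrow> e - 1 < x" if "x \<le> k" for x
        using prems(8)[OF that] 3 by auto
      show "(x, y + 1) \<notin> ?S1" if "x \<le> k" for x
        using prems(9)[OF that] by auto
      show "(K + 1, y - 1) \<in> ?S1" if "(K + 1, y) \<in> ?S1"
        using that prems(10) cK by auto
    qed (use prems 3 cK in auto)
    moreover have "(?S1 - {c + 1..K} \<times> {y}) \<union> {e - 1 - (K - (c + 1))..e - 1} \<times> {y - 1} =
        (S - {e..K} \<times> {y}) \<union> {c - (K - e)..c} \<times> {y - 1}"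
      using 3 cK by auto
    ultimately show ?thesis using s1 by simp
  qed
qed

text \<open>The cell \<open>(x, y)\<close> with neighbours in directions \<open>(1, 0)\<close> and \<open>(0, -1)\<close> but none in
  direction \<open>(1, -1)\<close> can be pushed in direction \<open>(1, -1)\<close> unless \<open>(x + 2, y - 2)\<close> blocks it, and
  then \<open>(x + 2, y - 2)\<close> is again such a cell, or can be pulled towards \<open>(x, y)\<close>.\<close>

lemma tower:
  assumes "polyhex S" "\<And>p. p \<in> S \<Longrightarrow> fst p \<le> M"
    and "(x, y) \<in> S" "(x, y + 1) \<notin> S" "(x - 1, y + 1) \<notin> S"
  shows "(\<exists>j\<ge>0. slides S (move S (x + 2 * j, y - 2 * j) (x + 2 * j + 1, y - 2 * j - 1)) \<and>
            (x + 2 * j, y - 2 * j) \<in> S \<and> (x + 2 * j + 1, y - 2 * j - 1) \<notin> S \<and>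
            (x + 2 * j + 1, y - 2 * j) \<in> S \<and> (x + 2 * j, y - 2 * j - 1) \<in> S) \<or>
         (\<exists>S'. slides S S' \<and> (\<forall>q. fst q \<le> x \<longrightarrow> (q \<in> S' \<longleftrightarrow> q \<in> S)) \<and> (\<forall>q\<in>S'. fst q \<le> M) \<and>
            ((x, y - 1) \<in> S' \<longrightarrow> (x + 1, y) \<in> S' \<longrightarrow> (x + 1, y - 1) \<in> S'))"
  using assms(3-5)
proof (induction "nat (M - x)" arbitrary: x y rule: less_induct)
  case less
  note prems = less.prems
  consider "(x, y - 1) \<in> S \<longrightarrow> (x + 1, y) \<in> S \<longrightarrow> (x + 1, y - 1) \<in> S"
    | "(x, y - 1) \<in> S" "(x + 1, y) \<in> S" "(x + 1, y - 1) \<notin> S"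
      "(x + 2, y - 2) \<in> S \<longrightarrow> (x + 1, y - 2) \<in> S \<or> (x + 2, y - 1) \<in> S"
    | "(x, y - 1) \<in> S" "(x + 1, y) \<in> S" "(x + 1, y - 1) \<notin> S"
      "(x + 2, y - 2) \<in> S" "(x + 1, y - 2) \<notin> S" "(x + 2, y - 1) \<notin> S"
    by blast
  then show ?case
  proof cases
    case 1
    then show ?thesis using assms(2) by (intro disjI2 exI[of _ S]) auto
  next
    case 2
    have "slide S (move S (x, y) (x + 1, y - 1))"
      by (rule slide_push) (use assms(1) prems 2 in auto)
    then show ?thesis using prems 2 by (intro disjI1 exI[of _ 0]) auto
  next
    case 3
    have "x + 2 \<le> M" using assms(2)[OF 3(4)] by simp
    then have m: "nat (M - (x + 2)) < nat (M - x)" by simp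
    \<comment> \<open>Two of the empty cells of this case are exactly the ones that the statement
      requires above \<open>(x + 2, y - 2)\<close>; the bound \<open>M\<close> ends the
      recursion.\<close>
    have "(x + 2, y - 2 + 1) \<notin> S" "(x + 2 - 1, y - 2 + 1) \<notin> S" using 3 by (simp_all add: algebra_simps)
    from less.hyps[OF m 3(4) this] show ?thesis
    proof
      assume "\<exists>j\<ge>0. slides S (move S (x + 2 + 2 * j, y - 2 - 2 * j) (x + 2 + 2 * j + 1, y - 2 - 2 * j - 1)) \<and>
            (x + 2 + 2 * j, y - 2 - 2 * j) \<in> S \<and> (x + 2 + 2 * j + 1, y - 2 - 2 * j - 1) \<notin> S \<and>
            (x + 2 + 2 * j + 1, y - 2 - 2 * j) \<in> S \<and> (x + 2 + 2 * j, y - 2 - 2 * j - 1) \<in> S"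
      then obtain j where "j \<ge> 0" and
        "slides S (move S (x + 2 + 2 * j, y - 2 - 2 * j) (x + 2 + 2 * j + 1, y - 2 - 2 * j - 1)) \<and>
            (x + 2 + 2 * j, y - 2 - 2 * j) \<in> S \<and> (x + 2 + 2 * j + 1, y - 2 - 2 * j - 1) \<notin> S \<and>
            (x + 2 + 2 * j + 1, y - 2 - 2 * j) \<in> S \<and> (x + 2 + 2 * j, y - 2 - 2 * j - 1) \<in> S"
        by blast
      then show ?thesis
        by (intro disjI1 exI[of _ "j + 1"]) (simp add: algebra_simps)
    next
      assume "\<exists>S'. slides S S' \<and> (\<forall>q. fst q \<le> x + 2 \<longrightarrow> (q \<in> S' \<longleftrightarrow> q \<in> S)) \<and> (\<forall>q\<in>S'. fst q \<le> M) \<and>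
            ((x + 2, y - 2 - 1) \<in> S' \<longrightarrow> (x + 2 + 1, y - 2) \<in> S' \<longrightarrow> (x + 2 + 1, y - 2 - 1) \<in> S')"
      then obtain S' where S': "slides S S'" and same: "\<And>q. fst q \<le> x + 2 \<Longrightarrow> q \<in> S' \<longleftrightarrow> q \<in> S"
        and M: "\<forall>q\<in>S'. fst q \<le> M"
        and V0: "(x + 2, y - 2 - 1) \<in> S' \<longrightarrow> (x + 2 + 1, y - 2) \<in> S' \<longrightarrow> (x + 2 + 1, y - 2 - 1) \<in> S'"
        by blast
      have V: "(x + 3, y - 3) \<in> S'" if "(x + 2, y - 3) \<in> S'" "(x + 3, y - 2) \<in> S'"
        using V0 that by (simp add: algebra_simps)
      have P: "polyhex S'" using S' assms(1) slides_polyhex by blast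
      have mem: "(x + 2, y - 2) \<in> S'" "(x, y) \<in> S'" "(x + 1, y) \<in> S'" "(x, y - 1) \<in> S'"
        "(x + 1, y - 1) \<notin> S'" "(x + 1, y - 2) \<notin> S'" "(x + 2, y - 1) \<notin> S'"
        using same 3 prems by auto
      \<comment> \<open>The blocking cell is not isolated, and its three neighbours towards the
        corner are empty, so it has a neighbour on the far side.\<close>
      obtain z where z: "z \<in> S'" "adj (x + 2, y - 2) z"
        using conn_set_has_neighbour[of S' "(x + 2, y - 2)" "(x, y)"] P mem
        by (auto simp: polyhex_def)
      then have fwd: "(x + 2, y - 3) \<in> S' \<or> (x + 3, y - 3) \<in> S' \<or> (x + 3, y - 2) \<in> S'"
        using mem by (cases z) (auto simp: adj_iff add.commute)
      \<comment> \<open>Pulling the blocking cell back fills \<open>(x + 1, y - 1)\<close>, so the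
        corner at \<open>(x, y)\<close> is gone.\<close>
      let ?S = "move S' (x + 2, y - 2) (x + 1, y - 1)"
      have "slide S' (move S' (x + 2, y - 2) (x + 2 - 1, y - 2 + 1))"
        by (rule slide_pull) (use P mem fwd V in \<open>simp_all add: algebra_simps\<close>)
      then have "slides S ?S" using S' by (simp add: add.commute)
      moreover have "(x + 1, y - 1) \<in> ?S" by (simp add: in_move_iff)
      moreover have "\<forall>q. fst q \<le> x \<longrightarrow> (q \<in> ?S \<longleftrightarrow> q \<in> S)"
        using same by (auto simp: in_move_iff)
      moreover have "\<forall>q\<in>?S. fst q \<le> M"
        using M \<open>x + 2 \<le> M\<close> by (auto simp: in_move_iff)
      ultimately show ?thesis by blast
    qed
  qed
qed

subsection \<open>Every hole-free configuration slides to a line\<close>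

definition comb :: "int \<Rightarrow> loc set \<Rightarrow> bool" where
  "comb k S \<longleftrightarrow> (\<forall>x y. x < k \<longrightarrow> (x, y) \<in> S \<longrightarrow> (x + 1, y) \<in> S)"

lemma comb_reach:
  assumes "comb k S" "(x, y) \<in> S" "x \<le> x'" "x' \<le> k"
  shows "(x', y) \<in> S"
  using assms(3,4)
proof (induction x' rule: int_ge_induct)
  case base
  then show ?case using assms(2) by simp
next
  case (step i)
  then show ?case using assms(1) by (simp add: comb_def)
qed

text \<open>The value \<open>e = k + 1\<close> encodes a row without cells up to column
  \<open>k\<close>.\<close>

lemma comb_row:
  assumes "comb k S" "finite S"
  obtains e where "e \<le> k + 1" "\<And>x. x \<le> k \<Longrightarrow> (x, y) \<in> S \<longleftrightarrow> e \<le> x"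
proof (cases "(k, y) \<in> S")
  case False
  then show ?thesis using that[of "k + 1"] comb_reach[OF assms(1)] by fastforce
next
  case True
  have "finite {x. (x, y) \<in> S}"
    using assms(2) by (rule finite_vimageI[where h = "\<lambda>x. (x, y)", unfolded vimage_def]) (simp add: inj_on_def)
  then have e: "(Min {x. (x, y) \<in> S}, y) \<in> S" "\<And>x. (x, y) \<in> S \<Longrightarrow> Min {x. (x, y) \<in> S} \<le> x"
    using True Min_in[of "{x. (x, y) \<in> S}"] by auto
  show ?thesis
  proof (rule that)
    show "Min {x. (x, y) \<in> S} \<le> k + 1" using e(2)[OF True] by simp
    show "(x, y) \<in> S \<longleftrightarrow> Min {x. (x, y) \<in> S} \<le> x" if "x \<le> k" for x
      using e comb_reach[OF assms(1) e(1)] that by blast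
  qed
qed

definition part :: "int \<Rightarrow> loc set \<Rightarrow> loc set" where
  "part k S = {p \<in> S. k \<le> fst p}"

text \<open>The rows that prevent \<open>comb k S\<close> from being
  \<open>comb (k + 1) S\<close>.\<close>

definition gaps :: "int \<Rightarrow> loc set \<Rightarrow> int set" where
  "gaps k S = {y. (k, y) \<in> S \<and> (k + 1, y) \<notin> S}"

lemma finite_part [simp]: "finite S \<Longrightarrow> finite (part k S)"
  by (simp add: part_def)

lemma finite_gaps: "finite S \<Longrightarrow> finite (gaps k S)"
  by (rule finite_subset[of _ "snd ` S"]) (force simp: gaps_def)+

lemma swap_card_sum:
  fixes g :: "'a \<Rightarrow> nat"
  assumes "finite A" "p \<in> A" "q \<notin> A"
  shows "card (insert q (A - {p})) = card A" "sum g (insert q (A - {p})) + g p = sum g A + g q"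
  using assms card_Suc_Diff1[of A p] sum.remove[of A p g] by (simp_all del: card_Diff_insert)

lemma segment_top:
  assumes "finite S" "(k, y) \<in> S"
  obtains b where "y \<le> b" "\<And>z. y \<le> z \<Longrightarrow> z \<le> b \<Longrightarrow> (k, z) \<in> S" "(k, b + 1) \<notin> (S :: loc set)"
proof -
  let ?P = "\<lambda>n. (k, y + int n) \<notin> S"
  have "\<exists>n. ?P n"
  proof (rule ccontr)
    assume "\<nexists>n. ?P n"
    then have "range (\<lambda>n. (k, y + int n)) \<subseteq> S" by auto
    moreover have "inj (\<lambda>n. (k, y + int n))" by (simp add: inj_def)
    ultimately show False using assms(1) by (meson finite_imageD finite_subset infinite_UNIV_nat)
  qed
  then have L: "?P (Least ?P)" "\<And>m. m < Least ?P \<Longrightarrow> \<not> ?P m"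
    using LeastI_ex[of ?P] not_less_Least[of _ ?P] by blast+
  have "Least ?P > 0" using L(1) assms(2) by (cases "Least ?P") auto
  show ?thesis
  proof (rule that[of "y + int (Least ?P) - 1"])
    show "(k, z) \<in> S" if "y \<le> z" "z \<le> y + int (Least ?P) - 1" for z
      using L(2)[of "nat (z - y)"] that by simp
  qed (use L(1) \<open>Least ?P > 0\<close> in auto)
qed

text \<open>Each entry belongs to one kind of step. Dropping a complete row takes a cell out of
  \<open>part\<close>; advancing the column lowers the second entry without raising the first; a
  push brings a cell one column closer to \<open>M\<close>; lowering a row with nothing beneath its
  column cell closes a gap.\<close>

definition sweep_order :: "int \<Rightarrow> ((int \<times> loc set) \<times> (int \<times> loc set)) set" where
  "sweep_order M = measures
     [\<lambda>(k, S). card (part k S), \<lambda>(k, S). nat (M + 1 - k),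
      \<lambda>(k, S). \<Sum>p\<in>part k S. nat (M - fst p), \<lambda>(k, S). card (gaps k S)]"

lemma wf_sweep_order: "wf (sweep_order M)"
  by (simp add: sweep_order_def)

text \<open>Every lattice neighbour of the row outside it is empty, so connectedness leaves room for
  nothing else. Here the sweep ends.\<close>

lemma isolated_row:
  assumes S: "conn_set S" and e: "\<And>x. x \<le> k \<Longrightarrow> (x, y) \<in> S \<longleftrightarrow> e \<le> x" "e \<le> k"
    and "(k + 1, y) \<notin> S" "(k + 1, y - 1) \<notin> S"
    and "\<And>x. x \<le> k \<Longrightarrow> (x, y + 1) \<notin> S" "\<And>x. x \<le> k \<Longrightarrow> (x, y - 1) \<notin> S"
  shows "S = {e..k} \<times> {y}"
proof
  show "{e..k} \<times> {y} \<subseteq> S" using e by auto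
  show "S \<subseteq> {e..k} \<times> {y}"
  proof
    fix p assume "p \<in> S"
    moreover have "(k, y) \<in> S" using e by simp
    ultimately have "connected_in S (k, y) p" using S by (simp add: conn_set_def)
    then show "p \<in> {e..k} \<times> {y}"
    proof (induction rule: connected_in_induct)
      case refl
      then show ?case using e by simp
    next
      case (step p q)
      obtain x where p: "p = (x, y)" "e \<le> x" "x \<le> k" using step by auto
      obtain u v where q: "q = (u, v)" by fastforce
      have "u \<le> k \<Longrightarrow> v = y \<Longrightarrow> e \<le> u" using e step.hyps(3) q by auto
      moreover have "(z, y - 1) \<notin> S" if "z \<le> k + 1" for z
        using assms(5,7) that by (cases "z = k + 1") auto
      moreover have "(z, y) \<in> S \<Longrightarrow> z \<noteq> k + 1" for z
        using assms(4) by auto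
      ultimately show ?case
        using step.hyps(2,3) assms(6) p q by (force simp: adj_iff)
    qed
  qed
qed

lemma slides_to_line:
  assumes "polyhex S" "S \<noteq> {}" "\<And>p. p \<in> S \<Longrightarrow> fst p \<le> M" "comb k S"
  shows "\<exists>a b y. slides S ({a..b} \<times> {y})"
  using assms
proof (induction "(k, S)" arbitrary: k S rule: wf_induct_rule[OF wf_sweep_order[of M]])
  case 1
  note IH = 1(1)
  note S = 1(2-5)
  have fin: "finite S" using S(1) by (simp add: polyhex_def)
  have go: ?case if "slides S S'" "comb k' S'" "\<forall>p\<in>S'. fst p \<le> M" "((k', S'), (k, S)) \<in> sweep_order M" for k' S'
  proof -
    have "polyhex S'" "card S' = card S" using slides_invariants[OF that(1) S(1)] by auto
    moreover from this have "S' \<noteq> {}" using S(2) fin by auto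
    ultimately have "\<exists>a b y. slides S' ({a..b} \<times> {y})" using IH[OF that(4)] that(2,3) by blast
    then show ?thesis using that(1) by (meson rtranclp_trans)
  qed
  have kM: "k \<le> M"
  proof (rule ccontr)
    assume "\<not> k \<le> M"
    obtain x y where p: "(x, y) \<in> S" using S(2) by fastforce
    have "x \<le> k" using S(3)[OF p] \<open>\<not> k \<le> M\<close> by simp
    then have "(k, y) \<in> S" using comb_reach[OF S(4) p] by simp
    then show False using S(3) \<open>\<not> k \<le> M\<close> by fastforce
  qed
  show ?case
  proof (cases "gaps k S = {}")
    case True
    have "comb (k + 1) S"
      unfolding comb_def
    proof (intro allI impI)
      fix x y assume "x < k + 1" "(x, y) \<in> S"
      then show "(x + 1, y) \<in> S"
        using S(4) True by (cases "x = k") (auto simp: comb_def gaps_def)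
    qed
    moreover have "card (part (k + 1) S) \<le> card (part k S)"
      using fin by (intro card_mono) (auto simp: part_def)
    then have "((k + 1, S), (k, S)) \<in> sweep_order M"
      using kM by (auto simp: sweep_order_def)
    ultimately show ?thesis using go[of S "k + 1"] S(3) by blast
  next
    case False
    \<comment> \<open>Below the lowest gap every cell of the column has a right neighbour. Going up
      to the top \<open>b\<close> of the vertical segment over it makes row \<open>b + 1\<close>
      empty up to column \<open>k\<close>.\<close>
    define y where "y = Min (gaps k S)"
    have y: "y \<in> gaps k S" "\<And>z. z \<in> gaps k S \<Longrightarrow> y \<le> z"
      using False finite_gaps[OF fin] by (auto simp: y_def)
    obtain b where b: "y \<le> b" "\<And>z. y \<le> z \<Longrightarrow> z \<le> b \<Longrightarrow> (k, z) \<in> S" "(k, b + 1) \<notin> S"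
      using segment_top[OF fin, of k y] y(1) by (auto simp: gaps_def)
    have kb: "(k, b) \<in> S" using b(1,2) by simp
    have above: "(x, b + 1) \<notin> S" if "x \<le> k" for x
      using comb_reach[OF S(4), of x "b + 1" k] b(3) that by blast
    obtain e where e: "e \<le> k + 1" "\<And>x. x \<le> k \<Longrightarrow> (x, b) \<in> S \<longleftrightarrow> e \<le> x"
      using comb_row[OF S(4) fin] by metis
    have ek: "e \<le> k" using e kb by simp
    show ?thesis
    proof (cases "(k, b - 1) \<in> S")
      case below: True
      obtain e' where e': "\<And>x. x \<le> k \<Longrightarrow> (x, b - 1) \<in> S \<longleftrightarrow> e' \<le> x" "e' \<le> k"
        using comb_row[OF S(4) fin, of "b - 1"] below by (metis order_refl)
      define c where "c = e' - 1"
      have c: "c < k" "\<And>x. x \<le> k \<Longrightarrow> (x, b - 1) \<in> S \<longleftrightarrow> c < x" using e' by (auto simp: c_def)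
      have "(k - 1, b + 1) \<notin> S" using above by simp
      from tower[OF S(1) S(3) kb b(3) this] show ?thesis
      proof
        assume "\<exists>j\<ge>0. slides S (move S (k + 2 * j, b - 2 * j) (k + 2 * j + 1, b - 2 * j - 1)) \<and>
            (k + 2 * j, b - 2 * j) \<in> S \<and> (k + 2 * j + 1, b - 2 * j - 1) \<notin> S \<and>
            (k + 2 * j + 1, b - 2 * j) \<in> S \<and> (k + 2 * j, b - 2 * j - 1) \<in> S"
        then obtain j where j: "j \<ge> 0"
          and sl: "slides S (move S (k + 2 * j, b - 2 * j) (k + 2 * j + 1, b - 2 * j - 1))"
          and mem: "(k + 2 * j, b - 2 * j) \<in> S" "(k + 2 * j + 1, b - 2 * j - 1) \<notin> S"
            "(k + 2 * j + 1, b - 2 * j) \<in> S"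
          by blast
        define p where "p = (k + 2 * j, b - 2 * j)"
        define q where "q = (k + 2 * j + 1, b - 2 * j - 1)"
        let ?S = "move S p q"
        have pq: "p \<in> part k S" "q \<notin> part k S" "fst p < M" "fst q = fst p + 1"
          using j mem S(3)[OF mem(3)] by (auto simp: part_def p_def q_def)
        have less: "((k, S'), (k, S)) \<in> sweep_order M" if "part k S' = insert q (part k S - {p})" for S'
        proof -
          have "nat (M - fst q) < nat (M - fst p)" using pq(3,4) by simp
          then have "(\<Sum>p\<in>part k S'. nat (M - fst p)) < (\<Sum>p\<in>part k S. nat (M - fst p))"
            using swap_card_sum(2)[OF finite_part[OF fin] pq(1,2), of "\<lambda>p. nat (M - fst p)"]
            unfolding that by linarith
          then show ?thesis
            using swap_card_sum(1)[OF finite_part[OF fin] pq(1,2)] that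
            by (simp add: sweep_order_def)
        qed
        have partS: "part k ?S = insert q (part k S - {p})"
          using j by (auto simp: part_def move_def q_def)
        have MS: "\<forall>p\<in>?S. fst p \<le> M" using S(3) pq by (auto simp: in_move_iff)
        show ?thesis
        \<comment> \<open>For \<open>j > 0\<close> the push happens to the right of the column and
          leaves the comb alone. For \<open>j = 0\<close> it removes the column cell of row
          \<open>b\<close>, and the rest of that row must be dropped to restore the comb.\<close>
        proof (cases "j = 0")
          case False
          then have "comb k ?S"
            using j S(4) by (auto simp: comb_def in_move_iff p_def q_def)
          then show ?thesis using go[of ?S k] sl less[OF partS] MS by (simp add: p_def q_def)
        next
          case True
          let ?T = "(?S - {e..k - 1} \<times> {b}) \<union> {c - (k - 1 - e)..c} \<times> {b - 1}"
          have pq0: "p = (k, b)" "q = (k + 1, b - 1)" by (simp_all add: p_def q_def True)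
          have "slides ?S ?T"
          proof (rule slides_drop_row)
            show "polyhex ?S" using sl S(1) slides_polyhex p_def q_def by blast
            show "(x + 1, z) \<in> ?S" if "z \<noteq> b" "x < k" "(x, z) \<in> ?S" for x z
              using that S(4) by (auto simp: comb_def in_move_iff pq0)
            show "(x, b) \<in> ?S \<longleftrightarrow> e \<le> x" if "x \<le> k - 1" for x
              using that e(2)[of x] by (auto simp: in_move_iff pq0)
            show "(x, b - 1) \<in> ?S \<longleftrightarrow> c < x" if "x \<le> k" for x
              using that c(2)[of x] by (auto simp: in_move_iff pq0)
            show "(x, b + 1) \<notin> ?S" if "x \<le> k" for x
              using that above[of x] by (auto simp: in_move_iff pq0)
          qed (use c ek in \<open>auto simp: in_move_iff pq0\<close>)
          then have "slides S ?T" using sl by (simp add: p_def q_def)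
          moreover have "comb k ?T"
            unfolding comb_def
          proof (intro allI impI)
            fix x z assume x: "x < k" "(x, z) \<in> ?T"
            consider "z = b" | "z = b - 1" | "z \<noteq> b" "z \<noteq> b - 1" by blast
            then show "(x + 1, z) \<in> ?T"
            proof cases
              case 1
              then show ?thesis using x e(2)[of x] by (auto simp: in_move_iff pq0)
            next
              case 2
              then show ?thesis using x c(2)[of x] c(2)[of "x + 1"] by (auto simp: in_move_iff pq0)
            next
              case 3
              then show ?thesis using x S(4) by (auto simp: in_move_iff pq0 comb_def)
            qed
          qed
          moreover have "part k ?T = insert q (part k S - {p})"
            using c(1) unfolding partS[symmetric] by (auto simp: part_def)
          moreover have "\<forall>p\<in>?T. fst p \<le> M" using MS c(1) kM by auto
          ultimately show ?thesis using go less by blast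
        qed
      next
        assume "\<exists>S'. slides S S' \<and> (\<forall>q. fst q \<le> k \<longrightarrow> (q \<in> S' \<longleftrightarrow> q \<in> S)) \<and> (\<forall>q\<in>S'. fst q \<le> M) \<and>
            ((k, b - 1) \<in> S' \<longrightarrow> (k + 1, b) \<in> S' \<longrightarrow> (k + 1, b - 1) \<in> S')"
        then obtain U where U: "slides S U" "\<And>q. fst q \<le> k \<Longrightarrow> q \<in> U \<longleftrightarrow> q \<in> S"
          "\<forall>q\<in>U. fst q \<le> M" "(k, b - 1) \<in> U \<longrightarrow> (k + 1, b) \<in> U \<longrightarrow> (k + 1, b - 1) \<in> U"
          by blast
        have same: "(x, z) \<in> U \<longleftrightarrow> (x, z) \<in> S" if "x \<le> k" for x z using U(2)[of "(x, z)"] that by simp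
        have PU: "polyhex U" "card U = card S" using slides_invariants[OF U(1) S(1)] by auto
        \<comment> \<open>The corner is resolved, so all of row \<open>b\<close> goes below, to
          columns up to \<open>c < k\<close>; \<open>part\<close> loses the cell
          \<open>(k, b)\<close>.\<close>
        let ?T = "(U - {e..k} \<times> {b}) \<union> {c - (k - e)..c} \<times> {b - 1}"
        have "slides U ?T"
        proof (rule slides_drop_row)
          show "(x + 1, z) \<in> U" if "z \<noteq> b" "x < k" "(x, z) \<in> U" for x z
            using that S(4) by (auto simp: comb_def same)
          show "(k + 1, b - 1) \<in> U" if "(k + 1, b) \<in> U"
            using that U(4) below same by simp
        qed (use c e ek above PU in \<open>auto simp: same\<close>)
        then have "slides S ?T" using U(1) by simp
        moreover have "comb k ?T"
          unfolding comb_def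
        proof (intro allI impI)
          fix x z assume x: "x < k" "(x, z) \<in> ?T"
          consider "z = b" | "z = b - 1" | "z \<noteq> b" "z \<noteq> b - 1" by blast
          then show "(x + 1, z) \<in> ?T"
          proof cases
            case 1
            then show ?thesis using x e(2)[of x] by (auto simp: same)
          next
            case 2
            then show ?thesis using x c(2)[of x] c(2)[of "x + 1"] by (auto simp: same)
          next
            case 3
            then show ?thesis using x S(4) by (auto simp: same comb_def)
          qed
        qed
        moreover have "card (part k ?T) < card (part k S)"
        proof -
          have finU: "finite U" using PU by (simp add: polyhex_def)
          have "U = part k U \<union> {p \<in> S. fst p < k}" "S = part k S \<union> {p \<in> S. fst p < k}"
          proof -
            have "p \<in> U \<longleftrightarrow> p \<in> part k U \<union> {p \<in> S. fst p < k}" for p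
              using U(2)[of p] by (cases "k \<le> fst p") (simp_all add: part_def)
            then show "U = part k U \<union> {p \<in> S. fst p < k}" by blast
          qed (auto simp: part_def)
          moreover have "part k U \<inter> {p \<in> S. fst p < k} = {}" "part k S \<inter> {p \<in> S. fst p < k} = {}"
            by (auto simp: part_def)
          ultimately have "card (part k U) = card (part k S)"
            using PU(2) fin finU card_Un_disjoint[of "part k U" "{p \<in> S. fst p < k}"]
              card_Un_disjoint[of "part k S" "{p \<in> S. fst p < k}"] by simp
          moreover have "part k ?T = part k U - {(k, b)}"
            using c(1) ek by (auto simp: part_def)
          moreover have "(k, b) \<in> part k U" using kb same by (simp add: part_def)
          ultimately show ?thesis using finU by (metis card_Diff1_less finite_part)
        qed
        then have "((k, ?T), (k, S)) \<in> sweep_order M" by (simp add: sweep_order_def)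
        moreover have "\<forall>p\<in>?T. fst p \<le> M" using U(3) c(1) kM by auto
        ultimately show ?thesis using go by blast
      qed
    next
      case below: False
      \<comment> \<open>A longer segment would contain \<open>(k, b - 1)\<close>.\<close>
      have "b = y"
        using b(1) b(2)[of "b - 1"] below by fastforce
      then have k1: "(k + 1, b) \<notin> S" using y(1) by (simp add: gaps_def)
      have under: "(x, b - 1) \<notin> S" if "x \<le> k" for x
        using comb_reach[OF S(4), of x "b - 1" k] below that by blast
      show ?thesis
      proof (cases "(k + 1, b - 1) \<in> S")
        case False
        have "S = {e..k} \<times> {b}"
          by (rule isolated_row) (use S e ek k1 False above under in \<open>auto simp: polyhex_def\<close>)
        then show ?thesis by blast
      next
        case True
        let ?T = "(S - {e..k} \<times> {b}) \<union> {e..k} \<times> {b - 1}"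
        have sl: "slides S ?T"
        proof (rule slides_down)
          \<comment> \<open>In column \<open>k\<close> this is the minimality of the gap
            \<open>y\<close>, further left it is the comb property.\<close>
          show "(x + 1, b - 2) \<in> S" if x: "x \<le> k" "(x, b - 2) \<in> S" for x
          proof (cases "x = k")
            case True
            then show ?thesis using x y(2)[of "b - 2"] \<open>b = y\<close> by (auto simp: gaps_def)
          next
            case False
            then show ?thesis using x S(4) by (simp add: comb_def)
          qed
        qed (use S(1) e ek above under True in auto)
        have comb: "comb k ?T"
          unfolding comb_def
        proof (intro allI impI)
          fix x z assume x: "x < k" "(x, z) \<in> ?T"
          then show "(x + 1, z) \<in> ?T"
            using S(4) e(2)[of x] under[of x] by (cases "z = b") (auto simp: comb_def)
        qed
        have part: "part k ?T = insert (k, b - 1) (part k S - {(k, b)})"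
          using ek by (auto simp: part_def)
        have "(k, b) \<in> part k S" "(k, b - 1) \<notin> part k S" using kb below by (auto simp: part_def)
        note sw = swap_card_sum[OF finite_part[OF fin] this]
        have "gaps k ?T = gaps k S - {b}"
          using True ek k1 below by (auto simp: gaps_def)
        moreover have "b \<in> gaps k S" using y(1) \<open>b = y\<close> by simp
        ultimately have "card (gaps k ?T) < card (gaps k S)"
          using finite_gaps[OF fin] by (metis card_Diff1_less)
        then have "((k, ?T), (k, S)) \<in> sweep_order M"
          using sw(1) sw(2)[of "\<lambda>p. nat (M - fst p)"] by (simp add: sweep_order_def part)
        moreover have "\<forall>p\<in>?T. fst p \<le> M" using S(3) kM by auto
        ultimately show ?thesis using go[OF sl comb] by blast
      qed
    qed
  qed
qed

subsection \<open>Perimeter and number of configurations\<close>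

lemma polyhex_to_line:
  assumes "polyhex S" "S \<noteq> {}"
  obtains a b y where "slides S ({a..b} \<times> {y})"
proof -
  have fin: "finite (fst ` S)" using assms(1) by (simp add: polyhex_def)
  \<comment> \<open>At the leftmost column the comb condition is void, so the sweep can start
    there.\<close>
  have "comb (Min (fst ` S)) S"
    unfolding comb_def
  proof (intro allI impI)
    fix x y assume "x < Min (fst ` S)" "(x, y) \<in> S"
    then show "(x + 1, y) \<in> S" using Min_le[OF fin, of x] by force
  qed
  then show ?thesis
    using slides_to_line[OF assms, of "Max (fst ` S)"] fin that by auto
qed

section \<open>Holes and the complement\<close>

lemma connected_in_vertical:
  assumes "\<And>t. (x, t) \<in> A"
  shows "connected_in A (x, y) (x, z)"
proof -
  have up: "connected_in A (x, y) (x, z)" if "y \<le> z" for y z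
    using that
  proof (induction z rule: int_ge_induct)
    case base
    then show ?case using assms by (intro connected_in_refl)
  next
    case (step i)
    then show ?case using assms by (auto intro: connected_in_step simp: adj_iff)
  qed
  then show ?thesis using connected_in_sym by (cases "y \<le> z") auto
qed

lemma connected_in_horizontal:
  assumes "\<And>t. (t, y) \<in> A"
  shows "connected_in A (x, y) (z, y)"
proof -
  have right: "connected_in A (x, y) (z, y)" if "x \<le> z" for x z
    using that
  proof (induction z rule: int_ge_induct)
    case base
    then show ?case using assms by (intro connected_in_refl)
  next
    case (step i)
    then show ?case using assms by (auto intro: connected_in_step simp: adj_iff)
  qed
  then show ?thesis using connected_in_sym by (cases "x \<le> z") auto
qed

text \<open>Outside a square one coordinate is out of range. Keep it fixed while the other becomes
  \<open>B + 1\<close>, then adjust it in turn.\<close>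

lemma connected_in_far:
  assumes "A \<supseteq> - ({-B..B} \<times> {-B..B})" "p \<notin> {-B..B} \<times> {-B..B}"
  shows "connected_in A p (B + 1, B + 1)"
proof -
  obtain x y where p: "p = (x, y)" by fastforce
  have v: "connected_in A (x, y) (x, z)" if "x \<notin> {-B..B}" for x y z
    using that assms(1) by (intro connected_in_vertical) auto
  have h: "connected_in A (x, y) (z, y)" if "y \<notin> {-B..B}" for x y z
    using that assms(1) by (intro connected_in_horizontal) auto
  show ?thesis
  proof (cases "x \<in> {-B..B}")
    case True
    then have "y \<notin> {-B..B}" using assms(2) p by auto
    then show ?thesis
      using connected_in_trans[OF h[of y x "B + 1"] v[of "B + 1" y "B + 1"]] p by simp
  next
    case False
    then show ?thesis
      using connected_in_trans[OF v[of x y "B + 1"] h[of "B + 1" x "B + 1"]] p by simp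
  qed
qed

text \<open>An infinite component of the complement must leave a box containing \<open>S\<close>,
  and the outside of the box is connected; conversely the complement of a finite set is
  infinite.\<close>

lemma no_holes_iff:
  assumes "finite S"
  shows "no_holes S \<longleftrightarrow> conn_set (- S)"
proof
  assume c: "conn_set (- S)"
  have "infinite (- S)"
    using assms infinite_loc by (metis Compl_eq_Diff_UNIV finite_Diff2)
  moreover have "{y. connected_in (- S) x y} = - S" if "x \<notin> S" for x
    using c that by (auto simp: conn_set_def dest: connected_in_mem)
  ultimately show "no_holes S" by (simp add: no_holes_def)
next
  assume nh: "no_holes S"
  obtain B where B: "S \<subseteq> {-B..B} \<times> {-B..B}"
  proof
    let ?B = "Max (insert 0 ((\<lambda>p. max \<bar>fst p\<bar> \<bar>snd p\<bar>) ` S))"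
    show "S \<subseteq> {-?B..?B} \<times> {-?B..?B}"
    proof
      fix p assume "p \<in> S"
      then have "max \<bar>fst p\<bar> \<bar>snd p\<bar> \<le> ?B" using assms by (intro Max_ge) auto
      then show "p \<in> {-?B..?B} \<times> {-?B..?B}" by (cases p) auto
    qed
  qed
  have far: "connected_in (- S) x (B + 1, B + 1)" if "x \<notin> S" for x
  proof -
    have "infinite {y. connected_in (- S) x y}" using nh that unfolding no_holes_def by blast
    then have "\<not> {y. connected_in (- S) x y} \<subseteq> {-B..B} \<times> {-B..B}"
      by (meson finite_SigmaI finite_atLeastAtMost_int finite_subset)
    then obtain y where y: "connected_in (- S) x y" "y \<notin> {-B..B} \<times> {-B..B}" by blast
    moreover have "connected_in (- S) y (B + 1, B + 1)"
      using B y(2) by (intro connected_in_far[where B = B]) auto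
    ultimately show ?thesis using connected_in_trans by blast
  qed
  show "conn_set (- S)"
    unfolding conn_set_def
  proof (intro ballI)
    fix x y assume "x \<in> - S" "y \<in> - S"
    then show "connected_in (- S) x y"
      using connected_in_trans[OF far connected_in_sym[OF far]] by simp
  qed
qed

lemma Omega_polyhex: "Omega n = {cls S | S. polyhex S \<and> card S = n}"
  unfolding Omega_def polyhex_def using no_holes_iff by blast

section \<open>Euler's formula and the perimeter\<close>

lemma nbrs_line: "nbrs ({a..b} \<times> {y}) (b, y) = (if a < b then {(b - 1, y)} else {})"
  by (auto simp: nbrs_def adj_iff)

lemma triangles_line: "triangles ({a..b} \<times> {y}) = {}"
proof -
  have False if T: "T \<subseteq> {a..b} \<times> {y}" "is_triangle T" for T
  proof -
    obtain u v w where uvw: "T = {u, v, w}" "u \<noteq> v" "v \<noteq> w" "u \<noteq> w"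
      using T(2) unfolding is_triangle_def card_3_iff by blast
    then have "adj u v" "adj v w" "adj u w" using T(2) by (auto simp: is_triangle_def)
    moreover have "snd u = y" "snd v = y" "snd w = y" using uvw(1) T(1) by auto
    ultimately show False by (cases u; cases v; cases w) (auto simp: adj_iff)
  qed
  then show ?thesis by (auto simp: triangles_def)
qed

lemma charge_line:
  assumes "a \<le> b"
  shows "charge ({a..b} \<times> {y}) = 2 * (b - a)"
  using assms
proof (induction b rule: int_ge_induct)
  case base
  have "nbrs {(a, y)} (a, y) = {}" by (auto simp: nbrs_def)
  then show ?case using triangles_line[of a a y] by (simp add: charge_def)
next
  case (step i)
  let ?S = "{a..i + 1} \<times> {y}"
  have "tri_count ?S (i + 1, y) = 0"
    using card_triangles_remove[of ?S "(i + 1, y)"] step.hyps by (simp add: triangles_line)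
  moreover have "?S - {(i + 1, y)} = {a..i} \<times> {y}" by auto
  ultimately show ?case
    using charge_remove[of ?S "(i + 1, y)"] step by (simp add: nbrs_line)
qed

text \<open>Charge and size survive all slides, so the value can be read off from the line at the
  end.\<close>

lemma charge_polyhex:
  assumes "polyhex S" "S \<noteq> {}"
  shows "charge S = 2 * int (card S) - 2"
proof -
  obtain a b y where sl: "slides S ({a..b} \<times> {y})" using polyhex_to_line[OF assms] .
  have inv: "card ({a..b} \<times> {y}) = card S" "charge ({a..b} \<times> {y}) = charge S"
    using slides_invariants[OF sl assms(1)] by auto
  have "card S > 0" using assms by (simp add: polyhex_def card_gt_0_iff)
  then have "a \<le> b" "int (card S) = b - a + 1" using inv(1) by (auto simp: card_cartesian_product)
  then show ?thesis using inv(2) charge_line by simp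
qed

lemma sum_tri_count:
  assumes "finite S"
  shows "(\<Sum>u\<in>S. tri_count S u) = 3 * card (triangles S)"
proof -
  have "(\<Sum>u\<in>S. card {T \<in> triangles S. u \<in> T}) = 3 * card (triangles S)"
  proof (rule sum_multicount)
    show "\<forall>T\<in>triangles S. card {u \<in> S. u \<in> T} = 3"
    proof
      fix T assume T: "T \<in> triangles S"
      then have "{u \<in> S. u \<in> T} = T" by (auto simp: triangles_def)
      then show "card {u \<in> S. u \<in> T} = 3" using T by (simp add: triangles_def is_triangle_def)
    qed
  qed (use assms in auto)
  moreover have "{T \<in> triangles S. u \<in> T} = {T. T \<subseteq> S \<and> u \<in> T \<and> is_triangle T}" for u
    by (auto simp: triangles_def)
  ultimately show ?thesis by (simp add: tri_count_def)
qed

text \<open>A directed edge either counts towards the perimeter or has a triangle on its left, and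
  every triangle is on the left of three of its directed edges.\<close>

lemma perim_eq:
  assumes "finite S"
  shows "perim S + 3 * card (triangles S) = (\<Sum>u\<in>S. card (nbrs S u))"
proof -
  have "{(u, v). u \<in> S \<and> v \<in> S \<and> adj u v \<and> left_vertex u v \<notin> S} =
      (SIGMA u:S. {v \<in> S. adj u v \<and> left_vertex u v \<notin> S})" by auto
  then have "perim S = (\<Sum>u\<in>S. card {v \<in> S. adj u v \<and> left_vertex u v \<notin> S})"
    using assms by (simp add: perim_def)
  moreover have "card (nbrs S u) = card {v \<in> S. adj u v \<and> left_vertex u v \<notin> S} + tri_count S u"
    if "u \<in> S" for u
  proof -
    have "nbrs S u = {v \<in> S. adj u v \<and> left_vertex u v \<notin> S} \<union> {v \<in> S. adj u v \<and> left_vertex u v \<in> S}"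
      by (auto simp: nbrs_def)
    moreover have "{v \<in> S. adj u v \<and> left_vertex u v \<notin> S} \<inter> {v \<in> S. adj u v \<and> left_vertex u v \<in> S} = {}"
      by blast
    ultimately show ?thesis
      using assms that by (simp add: tri_count_left_vertex card_Un_disjoint)
  qed
  ultimately show ?thesis using sum_tri_count[OF assms] by (simp add: sum.distrib)
qed

text \<open>With E edges and T triangles, \<open>perim_eq\<close> reads p = 2E - 3T, while the
  charge gives 2E - 2T = 2n - 2.\<close>

lemma perim_triangles:
  assumes "polyhex S" "S \<noteq> {}"
  shows "real (perim S) + real (card (triangles S)) = 2 * real (card S) - 2"
proof -
  have "finite S" using assms by (simp add: polyhex_def)
  then have "int (perim S) + int (card (triangles S)) = 2 * int (card S) - 2"
    using perim_eq[of S] charge_polyhex[OF assms] unfolding charge_def by linarith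
  then show ?thesis by linarith
qed

section \<open>Counting configurations by walks\<close>

fun visited :: "loc \<Rightarrow> loc list \<Rightarrow> loc set" where
  "visited p [] = {p}"
| "visited p (d # ds) = insert p (visited (ladd p d) ds)"

lemma visited_append: "visited p (ds @ es) = visited p ds \<union> visited (foldl ladd p ds) es"
proof (induction ds arbitrary: p)
  case Nil
  then show ?case by (cases es) auto
qed auto

lemma visited_split:
  "v \<in> visited p ds \<Longrightarrow> \<exists>es fs. ds = es @ fs \<and> foldl ladd p es = v"
proof (induction ds arbitrary: p)
  case (Cons d ds)
  show ?case
  proof (cases "v = p")
    case True
    then show ?thesis by (intro exI[of _ "[]"] exI[of _ "d # ds"]) simp
  next
    case False
    then have "v \<in> visited (ladd p d) ds" using Cons.prems by simp
    then obtain es fs where "ds = es @ fs" "foldl ladd (ladd p d) es = v" using Cons.IH by blast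
    then show ?thesis by (intro exI[of _ "d # es"] exI[of _ fs]) simp
  qed
qed simp

lemma start_visited: "p \<in> visited p ds"
  by (cases ds) auto

lemma conn_set_boundary:
  assumes "conn_set S" "V \<subseteq> S" "x \<in> V" "V \<noteq> S"
  obtains v w where "v \<in> V" "w \<in> S - V" "adj v w"
proof -
  obtain y where y: "y \<in> S" "y \<notin> V" using assms(2,4) by blast
  have "connected_in S x y" using assms(1-3) y by (auto simp: conn_set_def)
  then have "y \<in> V \<or> (\<exists>v\<in>V. \<exists>w\<in>S - V. adj v w)"
    by (induction rule: connected_in_induct) (use assms(3) in auto)
  then show ?thesis using y that by blast
qed

text \<open>The walk traverses the edges of a spanning tree
  twice, which is the source of the constant 36.\<close>

lemma visited_exhausts:
  assumes S: "conn_set S" "finite S" "x \<in> S" and m: "m < card S"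
  shows "\<exists>ds. set ds \<subseteq> lattice_dirs \<and> length ds = 2 * m \<and> visited x ds \<subseteq> S \<and> card (visited x ds) = m + 1"
  using m
proof (induction m)
  case 0
  then show ?case using S by (intro exI[of _ "[]"]) simp
next
  case (Suc m)
  then obtain ds where ds: "set ds \<subseteq> lattice_dirs" "length ds = 2 * m" "visited x ds \<subseteq> S"
    "card (visited x ds) = m + 1" by auto
  have "visited x ds \<noteq> S" using ds(4) Suc.prems by auto
  then obtain v w where vw: "v \<in> visited x ds" "w \<in> S - visited x ds" "adj v w"
    using conn_set_boundary[OF S(1) ds(3) start_visited] by blast
  obtain es fs where ef: "ds = es @ fs" "foldl ladd x es = v" using visited_split[OF vw(1)] by blast
  define d where "d = (fst w - fst v, snd w - snd v)"
  define d' where "d' = (fst v - fst w, snd v - snd w)"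
  have d: "ladd v d = w" "ladd w d' = v" "d \<in> lattice_dirs" "d' \<in> lattice_dirs"
    using vw(3) adj_sym[of v w] by (simp_all add: d_def d'_def ladd_def adj_def)
  \<comment> \<open>A detour from \<open>v\<close> to the new cell and back is spliced into the
    walk, which then continues as before.\<close>
  let ?ds = "es @ [d, d'] @ fs"
  have "visited x ?ds = insert w (visited x ds)"
    using ef d start_visited[of v fs] by (auto simp: visited_append)
  moreover have "finite (visited x ds)" using ds(3) S(2) finite_subset by blast
  ultimately show ?case
    using ds ef(1) d vw by (intro exI[of _ ?ds]) auto
qed

lemma shift_iff: "p \<in> shift a S \<longleftrightarrow> (fst p - fst a, snd p - snd a) \<in> S"
proof
  assume "(fst p - fst a, snd p - snd a) \<in> S"
  then show "p \<in> shift a S"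
    unfolding shift_def by (rule image_eqI[rotated]) (simp add: ladd_def)
qed (auto simp: shift_def ladd_def)

lemma shift_shift: "shift a (shift b S) = shift (ladd a b) S"
  by (auto simp: shift_iff ladd_def algebra_simps)

lemma shift_zero: "shift (0, 0) S = S"
  by (auto simp: shift_iff)

lemma cls_shift: "cls (shift a S) = cls S"
proof -
  have "shift b S = shift (fst b - fst a, snd b - snd a) (shift a S)" for b
    by (simp add: shift_shift ladd_def)
  then show ?thesis
    unfolding cls_def by (auto simp: shift_shift)
qed

lemma cls_eq_iff: "cls S = cls T \<longleftrightarrow> (\<exists>a. S = shift a T)"
proof
  assume "cls S = cls T"
  moreover have "S \<in> cls S" unfolding cls_def using shift_zero by (metis rangeI)
  ultimately show "\<exists>a. S = shift a T" by (auto simp: cls_def)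
qed (auto simp: cls_shift)

lemma rep_cls: "\<exists>a. rep (cls S) = shift a S"
proof -
  have "rep (cls S) \<in> cls S"
    unfolding rep_def by (rule someI[of _ S]) (metis cls_def rangeI shift_zero)
  then show ?thesis by (auto simp: cls_def)
qed

lemma visited_shift: "visited (ladd p a) ds = shift a (visited p ds)"
proof (induction ds arbitrary: p)
  case Nil
  then show ?case by (simp add: shift_def)
next
  case (Cons d ds)
  have "ladd (ladd p a) d = ladd (ladd p d) a" by (simp add: ladd_def)
  then show ?case using Cons by (simp add: shift_def)
qed

text \<open>Up to translation the covering walk starts at the origin, so its
  \<open>2 * (n - 1)\<close> directions, six choices each, determine the class.\<close>

lemma Omega_count:
  assumes "n > 0"
  shows "finite (Omega n)" "card (Omega n) \<le> 36 ^ (n - 1)"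
proof -
  let ?D = "{ds. set ds \<subseteq> lattice_dirs \<and> length ds = 2 * (n - 1)}"
  have fd: "finite lattice_dirs" "card lattice_dirs = 6" by (simp_all add: lattice_dirs_def)
  have sub: "Omega n \<subseteq> (\<lambda>ds. cls (visited (0, 0) ds)) ` ?D"
  proof
    fix C assume "C \<in> Omega n"
    then obtain S where S: "C = cls S" "polyhex S" "card S = n" by (auto simp: Omega_polyhex)
    then obtain x where x: "x \<in> S" using assms by (cases "S = {}") auto
    obtain ds where ds: "set ds \<subseteq> lattice_dirs" "length ds = 2 * (n - 1)" "visited x ds \<subseteq> S"
      "card (visited x ds) = n"
      using visited_exhausts[of S x "n - 1"] S x assms by (auto simp: polyhex_def)
    have "visited x ds = S"
      using ds(3,4) S by (simp add: card_subset_eq polyhex_def)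
    moreover have "visited x ds = shift x (visited (0, 0) ds)"
      using visited_shift[of "(0, 0)" x ds] by (simp add: ladd_def)
    ultimately have "C = cls (visited (0, 0) ds)" using S(1) cls_shift by metis
    then show "C \<in> (\<lambda>ds. cls (visited (0, 0) ds)) ` ?D" using ds by blast
  qed
  have finD: "finite ?D" using fd by (simp add: finite_lists_length_eq)
  then show "finite (Omega n)" using sub finite_surj by blast
  have "card (Omega n) \<le> card ?D" using sub finD by (rule surj_card_le[rotated])
  also have "\<dots> = 36 ^ (n - 1)" using fd by (simp add: card_lists_length_eq power_mult)
  finally show "card (Omega n) \<le> 36 ^ (n - 1)" .
qed

subsection \<open>Translations and reversibility\<close>

lemma adj_iff_dir: "adj l l' \<longleftrightarrow> l' \<in> ladd l ` lattice_dirs"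
proof
  assume "adj l l'"
  then show "l' \<in> ladd l ` lattice_dirs"
    unfolding adj_def by (rule image_eqI[rotated]) (simp add: ladd_def)
qed (auto simp: adj_def ladd_def)

definition neg :: "loc \<Rightarrow> loc" where
  "neg a = (- fst a, - snd a)"

lemma ladd_neg [simp]: "ladd (ladd u a) (neg a) = u" "ladd (ladd u (neg a)) a = u"
  by (simp_all add: ladd_def neg_def)

lemma shift_neg [simp]: "shift (neg a) (shift a S) = S" "shift a (shift (neg a) S) = S"
  by (simp_all add: shift_shift ladd_def neg_def shift_zero)

lemma ladd_inj [simp]: "ladd u a = ladd v a \<longleftrightarrow> u = v"
  by (auto simp: ladd_def prod_eq_iff)

lemma ladd_shift [simp]: "ladd u a \<in> shift a S \<longleftrightarrow> u \<in> S"
  by (simp add: shift_iff ladd_def)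

lemma adj_ladd [simp]: "adj (ladd u a) (ladd v a) \<longleftrightarrow> adj u v"
  by (simp add: adj_def ladd_def)

lemma shift_boolean:
  "shift a (A \<union> B) = shift a A \<union> shift a B" "shift a (A \<inter> B) = shift a A \<inter> shift a B"
  "shift a (A - B) = shift a A - shift a B" "shift a (- A) = - shift a A"
  "shift a (insert p A) = insert (ladd p a) (shift a A)" "shift a {} = {}"
  by (auto simp: shift_iff ladd_def prod_eq_iff)

lemma shift_eq_iff [simp]: "shift a A = shift a B \<longleftrightarrow> A = B"
  using shift_neg(1) by metis

lemma card_shift [simp]: "card (shift a S) = card S"
  unfolding shift_def by (rule card_image) (simp add: inj_on_def)

lemma finite_shift [simp]: "finite (shift a S) \<longleftrightarrow> finite S"
  unfolding shift_def by (rule finite_image_iff) (simp add: inj_on_def)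

lemma ball_shift: "(\<forall>p\<in>shift a S. P p) \<longleftrightarrow> (\<forall>p\<in>S. P (ladd p a))"
  and bex_shift: "(\<exists>p\<in>shift a S. P p) \<longleftrightarrow> (\<exists>p\<in>S. P (ladd p a))"
  by (simp_all add: shift_def)

text \<open>Transitions are computed at a representative chosen by \<open>SOME\<close>; the
  equivariance lemmas make the choice harmless.\<close>

lemma nbrs_shift: "nbrs (shift a S) (ladd l a) = shift a (nbrs S l)"
  by (auto simp: nbrs_def shift_iff adj_def ladd_def diff_diff_eq add.commute)

lemma connected_in_shift: "connected_in (shift a A) (ladd x a) (ladd y a) \<longleftrightarrow> connected_in A x y"
proof -
  have imp: "connected_in (shift a A) (ladd x a) (ladd y a)" if "connected_in A x y" for a A x y
    using that
  proof (induction rule: connected_in_induct)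
    case refl
    then show ?case using connected_in_mem[OF that] by (intro connected_in_refl) simp
  next
    case (step y z)
    then show ?case by (auto intro: connected_in_step)
  qed
  show ?thesis
    using imp[of A x y a] imp[of "shift a A" "ladd x a" "ladd y a" "neg a"] by auto
qed

lemma conn_set_shift: "conn_set (shift a A) \<longleftrightarrow> conn_set A"
  by (simp add: conn_set_def ball_shift connected_in_shift)

lemma property1_shift: "property1 (shift a S) (ladd l a) (ladd l' a) \<longleftrightarrow> property1 S l l'"
proof -
  have "{ladd l a, ladd l' a} = shift a {l, l'}" by (simp add: shift_boolean)
  then show ?thesis
    unfolding property1_def Let_def nbrs_shift
    by (simp only: shift_boolean(1-3)[symmetric] card_shift ball_shift bex_shift connected_in_shift)
qed

lemma property2_shift: "property2 (shift a S) (ladd l a) (ladd l' a) \<longleftrightarrow> property2 S l l'"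
proof -
  have e: "{ladd l a} = shift a {l}" "{ladd l' a} = shift a {l'}"
    by (simp_all add: shift_boolean)
  have empty: "shift a A = {} \<longleftrightarrow> A = {}" for A by (simp add: shift_def)
  show ?thesis
    unfolding property2_def nbrs_shift e shift_boolean(2,3)[symmetric] empty conn_set_shift ..
qed

lemma move_shift: "move (shift a S) (ladd l a) (ladd l' a) = shift a (move S l l')"
  by (simp add: move_def shift_boolean)

lemma polyhex_shift: "polyhex (shift a S) \<longleftrightarrow> polyhex S"
  by (simp add: polyhex_def conn_set_shift flip: shift_boolean(4))

lemma card_triangles_shift: "card (triangles (shift a S)) = card (triangles S)"
proof -
  have tri: "is_triangle (shift a T) \<longleftrightarrow> is_triangle T" for T
    by (simp add: is_triangle_def ball_shift)
  have sub: "shift a U \<subseteq> shift a S \<longleftrightarrow> U \<subseteq> S" for U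
    by (simp add: subset_eq ball_shift)
  have "T \<in> triangles (shift a S) \<longleftrightarrow> T \<in> shift a ` triangles S" for T
  proof -
    obtain U where U: "T = shift a U" using shift_neg(2) by metis
    show ?thesis unfolding U by (auto simp: triangles_def tri sub image_iff)
  qed
  then have "triangles (shift a S) = shift a ` triangles S" by blast
  then show ?thesis by (simp add: card_image inj_on_def)
qed

section \<open>Reversing moves\<close>

definition valid_move :: "loc set \<Rightarrow> loc \<Rightarrow> loc \<Rightarrow> bool" where
  "valid_move S l l' \<longleftrightarrow> l \<in> S \<and> l' \<notin> S \<and> adj l l' \<and> move_ok S l l'"

lemma valid_move_shift: "valid_move (shift a S) (ladd l a) (ladd l' a) \<longleftrightarrow> valid_move S l l'"
  by (simp add: valid_move_def move_ok_def property1_shift property2_shift nbrs_shift)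

lemma move_back: "l \<in> S \<Longrightarrow> l' \<notin> S \<Longrightarrow> move (move S l l') l' l = S"
  by (auto simp: move_def)

text \<open>Both properties are symmetric in the two cells and blind to which of them is occupied.
  The condition on five neighbours is not: if it failed for the way back, all six neighbours of
  \<open>l'\<close> would have been occupied in \<open>S\<close>, making \<open>l'\<close> a
  hole.\<close>

lemma valid_move_back:
  assumes S: "polyhex S" and v: "valid_move S l l'"
  shows "valid_move (move S l l') l' l"
proof -
  let ?T = "move S l l'"
  have l: "l \<in> S" "l' \<notin> S" "adj l l'" "l \<noteq> l'" using v by (auto simp: valid_move_def)
  have n: "nbrs ?T l - {l'} = nbrs S l - {l'}" "nbrs ?T l' - {l} = nbrs S l' - {l}"
    "nbrs ?T l' \<inter> nbrs ?T l = nbrs S l \<inter> nbrs S l'"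
    "nbrs ?T l' \<union> nbrs ?T l - {l', l} = nbrs S l \<union> nbrs S l' - {l, l'}"
    using l by (auto simp: nbrs_def move_def)
  have p1: "property1 ?T l' l \<longleftrightarrow> property1 S l l'"
    unfolding property1_def Let_def n ..
  have p2: "property2 ?T l' l \<longleftrightarrow> property2 S l l'"
    unfolding property2_def n by blast
  have "card (nbrs ?T l') \<noteq> 5"
  proof
    assume c: "card (nbrs ?T l') = 5"
    let ?N = "{p. adj l' p}"
    have N: "?N = ladd l' ` lattice_dirs" by (simp add: adj_iff_dir)
    have "finite ?N" "card ?N \<le> 6"
      unfolding N using card_image_le[of lattice_dirs "ladd l'"] by (simp_all add: lattice_dirs_def)
    moreover have sub: "nbrs ?T l' \<subseteq> ?N - {l}" by (auto simp: nbrs_def move_def l)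
    moreover have "l \<in> ?N" using l adj_sym by simp
    ultimately have "finite (?N - {l})" "card (?N - {l}) \<le> card (nbrs ?T l')"
      using c by simp_all
    then have "nbrs ?T l' = ?N - {l}" using sub by (intro card_seteq)
    then have "p = l \<or> p \<in> nbrs ?T l'" if "adj l' p" for p using that by blast
    then have "p \<in> S" if "adj l' p" for p
      using that l(1) not_adj_self[of l'] unfolding nbrs_def move_def by blast
    then show False using polyhex_free_neighbour[OF S l(2)] by blast
  qed
  then show ?thesis
    using v l p1 p2 adj_sym by (auto simp: valid_move_def move_ok_def move_def)
qed

text \<open>Several moves may lead to the same class, so transition probabilities between classes
  are sums over this set.\<close>

definition moves_to :: "loc set \<Rightarrow> loc set set \<Rightarrow> (loc \<times> loc) set" where
  "moves_to S C = {(l, l'). valid_move S l l' \<and> cls (move S l l') = C}"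

lemma finite_moves_to: "finite S \<Longrightarrow> finite (moves_to S C)"
proof -
  assume "finite S"
  then have "finite (SIGMA l:S. ladd l ` lattice_dirs)" by (auto simp: lattice_dirs_def)
  moreover have "moves_to S C \<subseteq> (SIGMA l:S. ladd l ` lattice_dirs)"
  proof
    fix m assume "m \<in> moves_to S C"
    then show "m \<in> (SIGMA l:S. ladd l ` lattice_dirs)"
      by (auto simp: moves_to_def valid_move_def adj_iff_dir)
  qed
  ultimately show ?thesis
    using finite_subset by blast
qed

text \<open>Translating by \<open>a\<close> changes each coordinate sum by \<open>card S\<close>
  times that coordinate of \<open>a\<close>.\<close>

lemma shift_no_period:
  assumes "finite S" "S \<noteq> {}" "shift a S = shift b S"
  shows "a = b"
proof -
  have sum: "(\<Sum>p\<in>shift c S. g p) = (\<Sum>p\<in>S. g (ladd p c))" for c and g :: "loc \<Rightarrow> int"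
    unfolding shift_def by (subst sum.reindex) (auto simp: inj_on_def)
  have "(\<Sum>p\<in>S. fst (ladd p a)) = (\<Sum>p\<in>S. fst (ladd p b))"
    "(\<Sum>p\<in>S. snd (ladd p a)) = (\<Sum>p\<in>S. snd (ladd p b))"
    using assms(3) sum[symmetric] by metis+
  then show ?thesis
    using assms(1,2) by (simp add: ladd_def sum.distrib prod_eq_iff)
qed

text \<open>Each move is sent to its reversal, carried over to \<open>T\<close> by the translation
  \<open>off\<close>, which may differ from move to move. The map is injective because the
  translation can be recovered from the result of the reversed move.\<close>

lemma card_moves_to_le:
  assumes "polyhex S" "polyhex T" "T \<noteq> {}"
  shows "card (moves_to S (cls T)) \<le> card (moves_to T (cls S))"
proof -
  have fT: "finite T" and fS: "finite S" using assms by (auto simp: polyhex_def)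
  define off where "off = (\<lambda>(l, l'). SOME a. shift a (move S l l') = T)"
  define \<phi> where "\<phi> m = (ladd (snd m) (off m), ladd (fst m) (off m))" for m :: "loc \<times> loc"
  have off: "shift (off (l, l')) (move S l l') = T" if "(l, l') \<in> moves_to S (cls T)" for l l'
  proof -
    have "cls T = cls (move S l l')" using that by (simp add: moves_to_def)
    then have "\<exists>a. shift a (move S l l') = T" unfolding cls_eq_iff by blast
    then have "shift (SOME a. shift a (move S l l') = T) (move S l l') = T" by (rule someI_ex)
    then show ?thesis by (simp add: off_def)
  qed
  have undo: "move T (fst (\<phi> m)) (snd (\<phi> m)) = shift (off m) S \<and> valid_move T (fst (\<phi> m)) (snd (\<phi> m))"
    if "m \<in> moves_to S (cls T)" for m
  proof -
    obtain l l' where m: "m = (l, l')" by (meson surj_pair)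
    have v: "valid_move S l l'" using that m by (simp add: moves_to_def)
    have T: "T = shift (off m) (move S l l')" using off that m by simp
    have "valid_move T (ladd l' (off m)) (ladd l (off m))"
      unfolding T valid_move_shift by (rule valid_move_back[OF assms(1) v])
    moreover have "move T (ladd l' (off m)) (ladd l (off m)) = shift (off m) S"
      using v by (subst T) (simp add: move_shift move_back valid_move_def)
    ultimately show ?thesis by (simp add: \<phi>_def m)
  qed
  have "inj_on \<phi> (moves_to S (cls T))"
  proof (rule inj_onI)
    fix m k assume mk: "m \<in> moves_to S (cls T)" "k \<in> moves_to S (cls T)" "\<phi> m = \<phi> k"
    have "S \<noteq> {}" using mk(1) by (auto simp: moves_to_def valid_move_def)
    \<comment> \<open>Equal reversed moves end in the same translate of \<open>S\<close>.\<close>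
    moreover have "shift (off m) S = shift (off k) S" using undo mk by metis
    ultimately have "off m = off k" using shift_no_period fS by blast
    then show "m = k" using mk(3) by (simp add: \<phi>_def prod_eq_iff[of m k])
  qed
  moreover have "\<phi> ` moves_to S (cls T) \<subseteq> moves_to T (cls S)"
    using undo by (auto simp: moves_to_def \<phi>_def cls_shift)
  ultimately show ?thesis using finite_moves_to[OF fT] by (rule card_inj_on_le)
qed

lemma card_moves_to_sym:
  "polyhex S \<Longrightarrow> polyhex T \<Longrightarrow> S \<noteq> {} \<Longrightarrow> T \<noteq> {} \<Longrightarrow> card (moves_to S (cls T)) = card (moves_to T (cls S))"
  by (intro order.antisym card_moves_to_le)

subsection \<open>The stationary distribution\<close>

definition weight :: "real \<Rightarrow> loc set \<Rightarrow> real" where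
  "weight lam S = lam ^ card (triangles S)"

lemma weight_pos: "lam > 0 \<Longrightarrow> weight lam S > 0"
  by (simp add: weight_def)

lemma weight_cls: "cls S = cls T \<Longrightarrow> weight lam S = weight lam T"
  by (auto simp: cls_eq_iff weight_def card_triangles_shift)

lemma acc_prob_bounds: "lam > 0 \<Longrightarrow> 0 < acc_prob lam S l l' \<and> acc_prob lam S l l' \<le> 1"
  by (simp add: acc_prob_def zero_less_power_int)

text \<open>The Metropolis identity: the right side is symmetric in the two configurations. The
  exponent is the total change in triangles, since \<open>S\<close> without \<open>l\<close> and the
  new set without \<open>l'\<close> coincide.\<close>

lemma weight_acc_prob:
  assumes "lam > 0" "finite S" "valid_move S l l'"
  shows "weight lam S * acc_prob lam S l l' = min (weight lam S) (weight lam (move S l l'))"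
proof -
  let ?T = "move S l l'"
  have v: "l \<in> S" "l' \<notin> S" using assms(3) by (auto simp: valid_move_def)
  have "?T - {l'} = S - {l}" using v by (auto simp: move_def)
  then have "card (triangles S) + tri_count ?T l' = card (triangles ?T) + tri_count S l"
    using card_triangles_remove[of S l] card_triangles_remove[of ?T l'] assms(2) v
    by (simp add: move_def)
  then have "int (tri_count ?T l') - int (tri_count S l) = int (card (triangles ?T)) - int (card (triangles S))"
    by linarith
  then have "acc_prob lam S l l' = min 1 (weight lam ?T / weight lam S)"
    using assms(1) by (simp add: acc_prob_def weight_def power_int_diff)
  then show ?thesis
    using weight_pos[OF assms(1), of S] by (simp add: min_mult_distrib_left)
qed

text \<open>As \<open>C\<close> is another class, all contributions of staying put vanish.\<close>

lemma step_prob_moves: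
  assumes "finite S" "C \<noteq> cls S"
  shows "step_prob lam S C = 1 / (6 * real (card S)) * (\<Sum>(l, l')\<in>moves_to S C. acc_prob lam S l l')"
proof -
  let ?f = "\<lambda>(l, l'). if (l, l') \<in> moves_to S C then acc_prob lam S l l' else 0"
  let ?E = "SIGMA l:S. ladd l ` lattice_dirs"
  have fin: "finite lattice_dirs" "finite ?E" using assms(1) by (auto simp: lattice_dirs_def)
  have "(let l' = ladd l d in if l' \<notin> S \<and> move_ok S l l'
         then acc_prob lam S l l' * ind (cls (move S l l') = C) + (1 - acc_prob lam S l l') * ind (cls S = C)
         else ind (cls S = C)) = ?f (l, ladd l d)" if "l \<in> S" "d \<in> lattice_dirs" for l d
    using that assms(2) by (auto simp: Let_def ind_def moves_to_def valid_move_def adj_iff_dir)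
  then have "step_prob lam S C = 1 / (6 * real (card S)) * (\<Sum>l\<in>S. \<Sum>d\<in>lattice_dirs. ?f (l, ladd l d))"
    unfolding step_prob_def by (metis (no_types, lifting) sum.cong)
  also have "(\<Sum>l\<in>S. \<Sum>d\<in>lattice_dirs. ?f (l, ladd l d)) = (\<Sum>l\<in>S. \<Sum>l'\<in>ladd l ` lattice_dirs. ?f (l, l'))"
  proof -
    have "inj_on (ladd l) lattice_dirs" for l by (auto simp: inj_on_def ladd_def prod_eq_iff)
    then show ?thesis by (simp only: sum.reindex comp_def)
  qed
  also have "\<dots> = sum ?f ?E"
    using assms(1) fin(1) by (subst sum.Sigma) auto
  also have "\<dots> = (\<Sum>m\<in>moves_to S C. ?f m)"
  proof (rule sum.mono_neutral_right)
    show "moves_to S C \<subseteq> ?E" by (auto simp: moves_to_def valid_move_def adj_iff_dir)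
  qed (use fin in auto)
  also have "\<dots> = (\<Sum>(l, l')\<in>moves_to S C. acc_prob lam S l l')"
    by (intro sum.cong) auto
  finally show ?thesis .
qed

text \<open>Together with \<open>card_moves_to_sym\<close> this form makes detailed balance
  evident.\<close>

lemma weight_step_prob:
  assumes "lam > 0" "finite S" "cls T \<noteq> cls S"
  shows "weight lam S * step_prob lam S (cls T) =
    real (card (moves_to S (cls T))) * min (weight lam S) (weight lam T) / (6 * real (card S))"
proof -
  have "weight lam S * (\<Sum>(l, l')\<in>moves_to S (cls T). acc_prob lam S l l') =
      (\<Sum>(l, l')\<in>moves_to S (cls T). weight lam S * acc_prob lam S l l')"
    by (simp add: sum_distrib_left case_prod_unfold)
  also have "\<dots> = (\<Sum>(l, l')\<in>moves_to S (cls T). min (weight lam S) (weight lam T))"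
  proof (rule sum.cong[OF refl], clarify)
    fix a b c d assume "((a, b), (c, d)) \<in> moves_to S (cls T)"
    then have v: "valid_move S (a, b) (c, d)" and c: "cls (move S (a, b) (c, d)) = cls T"
      by (auto simp: moves_to_def)
    show "weight lam S * acc_prob lam S (a, b) (c, d) = min (weight lam S) (weight lam T)"
      unfolding weight_acc_prob[OF assms(1,2) v] weight_cls[OF c] ..
  qed
  also have "\<dots> = real (card (moves_to S (cls T))) * min (weight lam S) (weight lam T)"
    by (simp add: case_prod_unfold)
  finally show ?thesis
    using step_prob_moves[OF assms(2,3), of lam] by (simp add: field_simps)
qed

lemma Omega_rep:
  assumes "C \<in> Omega n"
  shows "polyhex (rep C)" "card (rep C) = n" "cls (rep C) = C"
proof -
  obtain S where S: "C = cls S" "polyhex S" "card S = n" using assms by (auto simp: Omega_polyhex)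
  obtain a where "rep C = shift a S" using rep_cls S(1) by blast
  then show "polyhex (rep C)" "card (rep C) = n" "cls (rep C) = C"
    using S by (auto simp: polyhex_shift cls_shift)
qed

lemma detailed_balance:
  assumes "lam > 0" "n > 0" "C \<in> Omega n" "D \<in> Omega n"
  shows "weight lam (rep C) * trans_prob lam C D = weight lam (rep D) * trans_prob lam D C"
proof (cases "C = D")
  case False
  note C = Omega_rep[OF assms(3)] and D = Omega_rep[OF assms(4)]
  have "rep C \<noteq> {}" "rep D \<noteq> {}" using C(2) D(2) assms(2) by auto
  then have "card (moves_to (rep C) D) = card (moves_to (rep D) C)"
    using card_moves_to_sym[OF C(1) D(1)] C(3) D(3) by simp
  then show ?thesis
    using weight_step_prob[OF assms(1), of "rep C" "rep D"] weight_step_prob[OF assms(1), of "rep D" "rep C"]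
      C D False by (simp add: trans_prob_def polyhex_def min.commute)
qed simp

section \<open>Maximum principle for the stationary distribution\<close>

lemma step_prob_nonneg: "lam > 0 \<Longrightarrow> 0 \<le> step_prob lam S C"
  unfolding step_prob_def Let_def using acc_prob_bounds
  by (intro mult_nonneg_nonneg sum_nonneg) (auto simp: ind_def less_imp_le)

lemma sum_ind_le: "finite A \<Longrightarrow> (\<Sum>C\<in>A. ind (X = C)) \<le> 1"
  by (simp add: ind_def)

lemma sum_step_prob_le:
  assumes "lam > 0" "finite A" "finite S" "S \<noteq> {}"
  shows "(\<Sum>C\<in>A. step_prob lam S C) \<le> 1"
proof -
  let ?t = "\<lambda>l d C. (let l' = ladd l d in if l' \<notin> S \<and> move_ok S l l'
         then acc_prob lam S l l' * ind (cls (move S l l') = C) + (1 - acc_prob lam S l l') * ind (cls S = C)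
         else ind (cls S = C))"
  have one: "(\<Sum>C\<in>A. ?t l d C) \<le> 1" for l d
  proof -
    define a where "a = acc_prob lam S l (ladd l d)"
    have a: "0 \<le> a" "a \<le> 1" using acc_prob_bounds[OF assms(1), of S l "ladd l d"] by (auto simp: a_def)
    \<comment> \<open>An accepted or rejected proposal is a mixture of two point masses, each of
      which gives \<open>A\<close> at most 1.\<close>
    have mix: "a * (\<Sum>C\<in>A. ind (X = C)) + (1 - a) * (\<Sum>C\<in>A. ind (Y = C)) \<le> a * 1 + (1 - a) * 1" for X Y
      using a sum_ind_le[OF assms(2)] by (intro add_mono mult_left_mono) auto
    show ?thesis
    proof (cases "ladd l d \<notin> S \<and> move_ok S l (ladd l d)")
      case True
      show ?thesis
        unfolding Let_def if_P[OF True] a_def[symmetric]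
        using mix by (simp add: sum.distrib sum_distrib_left[symmetric])
    next
      case False
      show ?thesis
        unfolding Let_def if_not_P[OF False] using sum_ind_le[OF assms(2)] .
    qed
  qed
  have "(\<Sum>C\<in>A. step_prob lam S C) = 1 / (6 * real (card S)) * (\<Sum>l\<in>S. \<Sum>d\<in>lattice_dirs. \<Sum>C\<in>A. ?t l d C)"
    unfolding step_prob_def sum_distrib_left[symmetric]
    by (subst sum.swap, subst (2) sum.swap) simp
  also have "\<dots> \<le> 1 / (6 * real (card S)) * (\<Sum>l\<in>S. \<Sum>d\<in>lattice_dirs. 1)"
    using one by (intro mult_left_mono sum_mono) auto
  also have "\<dots> = 1" using assms(3,4) by (simp add: lattice_dirs_def)
  finally show ?thesis .
qed

lemma trans_prob_pos:
  assumes "lam > 0" "polyhex S" "S \<noteq> {}" "slide S T" "cls T \<noteq> cls S"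
  shows "trans_prob lam (cls S) (cls T) > 0"
proof -
  obtain a where a: "rep (cls S) = shift a S" using rep_cls by blast
  obtain l l' where "valid_move S l l'" "T = move S l l'"
    using assms(4) by (auto simp: slide_def valid_move_def)
  then have "(ladd l a, ladd l' a) \<in> moves_to (shift a S) (cls T)"
    by (simp add: moves_to_def valid_move_shift move_shift cls_shift)
  moreover have fin: "finite (shift a S)" using assms(2) by (simp add: polyhex_def)
  ultimately have "(\<Sum>(l, l')\<in>moves_to (shift a S) (cls T). acc_prob lam (shift a S) l l') > 0"
    using acc_prob_bounds[OF assms(1)] finite_moves_to by (intro sum_pos) auto
  moreover have "card S > 0" using assms(2,3) by (simp add: polyhex_def card_gt_0_iff)
  ultimately show ?thesis
    using step_prob_moves[OF fin, of "cls T" lam] assms(5) by (simp add: trans_prob_def a cls_shift)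
qed

text \<open>By detailed balance \<open>\<pi> / weight\<close> is harmonic, so its maximum propagates along valid moves
  until it reaches a line, where the weight is 1.\<close>

lemma stationary_le_weight:
  assumes lam: "lam > 0" and n: "n > 0" and st: "stationary lam n \<pi>" and C: "C \<in> Omega n"
  shows "\<pi> C \<le> weight lam (rep C)"
proof -
  let ?w = "\<lambda>C. weight lam (rep C)"
  define h where "h C = \<pi> C / ?w C" for C
  have fin: "finite (Omega n)" using Omega_count n by blast
  have w: "?w C > 0" for C using weight_pos[OF lam] .
  have pi: "\<And>C. C \<in> Omega n \<Longrightarrow> 0 \<le> \<pi> C" "(\<Sum>C\<in>Omega n. \<pi> C) = 1"
    "\<And>D. D \<in> Omega n \<Longrightarrow> (\<Sum>C\<in>Omega n. \<pi> C * trans_prob lam C D) = \<pi> D"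
    using st by (auto simp: stationary_def)
  \<comment> \<open>Detailed balance turns invariance of \<open>\<pi>\<close> into harmonicity of
    its quotient by the weight.\<close>
  have harm: "(\<Sum>C\<in>Omega n. trans_prob lam D C * h C) = h D" if D: "D \<in> Omega n" for D
  proof -
    have "\<pi> C * trans_prob lam C D = ?w D * (trans_prob lam D C * h C)" if "C \<in> Omega n" for C
    proof -
      have "\<pi> C * trans_prob lam C D = h C * (?w C * trans_prob lam C D)"
        using w[of C] by (simp add: h_def)
      then show ?thesis using detailed_balance[OF lam n that D] by simp
    qed
    then have "\<pi> D = ?w D * (\<Sum>C\<in>Omega n. trans_prob lam D C * h C)"
      using pi(3)[OF D] by (simp add: sum_distrib_left)
    then show ?thesis using w[of D] by (simp add: h_def)
  qed
  define m where "m = Max (h ` Omega n)"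
  have hm: "h D \<le> m" if "D \<in> Omega n" for D using fin that by (simp add: m_def)
  have "m \<in> h ` Omega n" unfolding m_def using fin C by (intro Max_in) auto
  then obtain D where D: "D \<in> Omega n" "h D = m" by auto
  \<comment> \<open>The row sums are bounded by 1 from above, so a nonnegative \<open>m\<close> is
    what makes the comparison with the average work.\<close>
  have m0: "m \<ge> 0" using D pi(1) w[of D] by (auto simp: h_def)
  have next_max: "h E = m" if D: "D \<in> Omega n" "h D = m" and E: "E \<in> Omega n" "trans_prob lam D E > 0" for D E
  proof -
    have nn: "0 \<le> trans_prob lam D C" for C using step_prob_nonneg[OF lam] by (simp add: trans_prob_def)
    have "rep D \<noteq> {}" "finite (rep D)" using Omega_rep[OF D(1)] n by (auto simp: polyhex_def)
    then have "(\<Sum>C\<in>Omega n. trans_prob lam D C) \<le> 1"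
      using sum_step_prob_le[OF lam fin] by (simp add: trans_prob_def)
    then have "m * (\<Sum>C\<in>Omega n. trans_prob lam D C) \<le> m" using m0 by (simp add: mult_left_le)
    then have "(\<Sum>C\<in>Omega n. trans_prob lam D C * (m - h C)) \<le> 0"
      using harm[OF D(1)] D(2)
      by (simp add: right_diff_distrib sum_subtractf sum_distrib_left mult.commute)
    \<comment> \<open>All summands are nonnegative, hence each one is bounded by the nonpositive
      sum.\<close>
    moreover have "trans_prob lam D E * (m - h E) \<le> (\<Sum>C\<in>Omega n. trans_prob lam D C * (m - h C))"
      using nn hm E(1) fin by (intro member_le_sum) auto
    ultimately have "trans_prob lam D E * (m - h E) \<le> 0" by linarith
    then have "m - h E \<le> 0" using E(2) by (simp add: mult_le_0_iff)
    then show ?thesis using hm[OF E(1)] by simp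
  qed
  note R = Omega_rep[OF D(1)]
  have "rep D \<noteq> {}" using R(2) n by auto
  then obtain a b y where sl: "slides (rep D) ({a..b} \<times> {y})" using polyhex_to_line R(1) by blast
  define L where "L = {a..b} \<times> {y}"
  have "polyhex U \<and> card U = n \<and> h (cls U) = m" if "slides (rep D) U" for U
    using that
  proof (induction rule: rtranclp_induct)
    case base
    then show ?case using R D by simp
  next
    case (step U V)
    have V: "polyhex V" "card V = n"
      using slide_card[OF step.hyps(2)] step.IH step.hyps(2) by (simp_all add: slide_def)
    have "cls U \<in> Omega n" "cls V \<in> Omega n" "U \<noteq> {}"
      using V step.IH n by (auto simp: Omega_polyhex)
    \<comment> \<open>A slide may end in a translate of its start, which is the same class;
      otherwise it has positive probability.\<close>
    then have "h (cls V) = m"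
      using next_max[of "cls U" "cls V"] trans_prob_pos[OF lam, of U V] step
      by (cases "cls V = cls U") auto
    then show ?case using V by simp
  qed
  then have L: "cls L \<in> Omega n" "h (cls L) = m" using sl by (auto simp: L_def Omega_polyhex)
  have "?w (cls L) = weight lam L"
    by (rule weight_cls) (rule Omega_rep(3)[OF L(1)])
  then have "?w (cls L) = 1" by (simp add: weight_def L_def triangles_line)
  \<comment> \<open>On a line the quotient is a probability, which bounds the maximum by 1.\<close>
  then have "m = \<pi> (cls L)" using L(2) by (simp add: h_def)
  also have "\<dots> \<le> 1" using member_le_sum[of "cls L" "Omega n" \<pi>] L(1) pi(1,2) fin by auto
  finally have "h C \<le> 1" using hm[OF C] by simp
  then show ?thesis using w[of C] by (simp add: h_def)
qed

theorem theorem3: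
  fixes \<beta> :: real
  assumes "0 < \<beta>" and "\<beta> < 1"
  shows "\<exists>lam_star::real. \<exists>n0::nat. \<exists>\<gamma>::real.
           0 < lam_star \<and> lam_star < sqrt 2 \<and> 0 < \<gamma> \<and> \<gamma> < 1 \<and>
           (\<forall>(lam::real) (n::nat) \<pi>. 0 < lam \<and> lam < lam_star \<and> n > n0 \<and> stationary lam n \<pi> \<longrightarrow>
              (\<Sum>C\<in>{C \<in> Omega n. real (perimC C) < \<beta> * (2 * real n - 2)}. \<pi> C)
                \<le> \<gamma> powr sqrt (real n))"
proof -
  \<comment> \<open>A perimeter below the threshold forces more than \<open>e * (n - 1)\<close>
    triangles. The value \<open>ls\<close> solves \<open>ls powr e = 1 / 144\<close>, and 144 is 4
    times 36: against the count \<open>36 ^ (n - 1)\<close> a factor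
    \<open>(1 / 4) ^ (n - 1)\<close> remains.\<close>
  define e where "e = 2 * (1 - \<beta>)"
  define ls where "ls = (1 / 144 :: real) powr (1 / e)"
  have e: "e > 0" using assms by (simp add: e_def)
  have ls: "0 < ls" "ls < 1"
    using e by (simp_all add: ls_def powr_def divide_neg_pos ln_less_zero)
  have bound: "(\<Sum>C\<in>{C \<in> Omega n. real (perimC C) < \<beta> * (2 * real n - 2)}. \<pi> C) \<le> (1 / 2) powr sqrt (real n)"
    if lam: "0 < lam" "lam < ls" and n: "n > 1" and st: "stationary lam n \<pi>" for lam n \<pi>
  proof -
    let ?A = "{C \<in> Omega n. real (perimC C) < \<beta> * (2 * real n - 2)}"
    let ?q = "(1 / 144 :: real) ^ (n - 1)"
    have each: "\<pi> C \<le> ?q" if C: "C \<in> ?A" for C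
    proof -
      let ?t = "card (triangles (rep C))"
      have O: "C \<in> Omega n" and p: "real (perim (rep C)) < \<beta> * (2 * real n - 2)"
        using C by (simp_all add: perimC_def)
      have "rep C \<noteq> {}" using Omega_rep(2)[OF O] n by auto
      then have "real (perim (rep C)) + real ?t = 2 * real n - 2"
        using perim_triangles Omega_rep[OF O] by metis
      then have t: "e * real (n - 1) \<le> real ?t"
        using p n by (simp add: e_def of_nat_diff algebra_simps)
      have "\<pi> C \<le> lam ^ ?t"
        using stationary_le_weight[OF lam(1) _ st O] n by (simp add: weight_def)
      also have "\<dots> \<le> ls ^ ?t" using lam by (intro power_mono) auto
      also have "\<dots> = ls powr real ?t" using ls by (simp add: powr_realpow)
      also have "\<dots> \<le> ls powr (e * real (n - 1))" using t ls by (intro powr_mono') auto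
      also have "\<dots> = ?q" using e by (simp add: ls_def powr_powr powr_realpow[symmetric])
      finally show ?thesis .
    qed
    have fin: "finite (Omega n)" and c: "card (Omega n) \<le> 36 ^ (n - 1)" using Omega_count n by auto
    have "card ?A \<le> card (Omega n)" using fin by (intro card_mono) auto
    then have cA: "real (card ?A) \<le> 36 ^ (n - 1)"
      using c by (simp add: of_nat_le_numeral_power_cancel_iff)
    have "(\<Sum>C\<in>?A. \<pi> C) \<le> real (card ?A) * ?q" using each by (rule sum_bounded_above)
    also have "\<dots> \<le> 36 ^ (n - 1) * ?q" using cA by (rule mult_right_mono) simp
    also have "\<dots> = (1 / 4) ^ (n - 1)" by (simp add: power_mult_distrib[symmetric])
    also have "\<dots> = (1 / 2) powr (2 * real (n - 1))"
    proof -
      have "(1 / 2 :: real) powr real (2 * (n - 1)) = (1 / 2) ^ (2 * (n - 1))"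
        by (rule powr_realpow) simp
      then show ?thesis by (simp add: power_mult power2_eq_square)
    qed
    also have "\<dots> \<le> (1 / 2) powr sqrt (real n)"
    proof (rule powr_mono')
      have "sqrt (real n) \<le> real n" using n by (intro real_le_lsqrt) (auto simp: power2_eq_square)
      \<comment> \<open>For \<open>n > 1\<close> one has \<open>n \<le> 2 * (n - 1)\<close>; this
        fixes the threshold 1 for \<open>n\<close>.\<close>
      then show "sqrt (real n) \<le> 2 * real (n - 1)" using n by (simp add: of_nat_diff)
    qed auto
    finally show ?thesis .
  qed
  have "1 < sqrt (2 :: real)" by simp
  then have "ls < sqrt 2" using ls(2) by linarith
  then show ?thesis
    using ls bound by (intro exI[of _ ls] exI[of _ 1] exI[of _ "1 / 2"]) auto
qed

end
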